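(* Let $X \sim (B,\sigma^2,\gamma)$ with $\mathcal{G}(B)$ a directed acyclic graph. Suppose the covariance matrix $\Sigma=\mathbb{E}(XX^T)$ has minimum eigenvalue $\lambda_{\min}>0$. Let $\epsilon>0$ and let $\hat\Sigma$ be the sample covariance matrix of $n$ i.i.d. copies of $X$. If $$ n \;>\; p^2\left\{\log(p^2+p)-\log(\epsilon/2)\right\}\,128\left(1+4\frac{\gamma^2}{\sigma^2}\right)^2\left(\max_{j\in V}\Sigma_{j,j}\right)^2\left(\frac{\zeta\lambda_{\min}+2\sigma^2}{\zeta\lambda_{\min}^2}\right)^2, $$ then the Topological Ordering algorithm with input $\hat\Sigma$ and criterion $$ f_1(\hat\Sigma,\Theta,j)=\hat\Sigma_{j,j}-\hat\Sigma_{j,\Theta}\hat\Sigma_{\Theta,\Theta}^{-1}\hat\Sigma_{\Theta,j} $$ outputs a topological ordering of $\mathcal{G}(B)$ with probability at least $1-\epsilon$.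
   Context: Model. Let $V=\{1,\dots,p\}$. For a real $p\times p$ matrix $B=(\beta_{jk})$ with zero diagonal and $\sigma^2>0$, write $X\sim(B,\sigma^2)$ if the random vector $X=(X_1,\dots,X_p)$ solves $X_j=\sum_{k\neq j}\beta_{jk}X_k+\varepsilon_j$, $j=1,\dots,p$, for independent mean-zero random variables $\varepsilon_1,\dots,\varepsilon_p$ all having the same variance $\sigma^2$. Write $X\sim(B,\sigma^2,\gamma)$ if in addition each $\varepsilon_j$ is sub-Gaussian with parameter at most $\gamma>0$, i.e. $\mathbb{E}\,e^{t\varepsilon_j}\le e^{\gamma^2t^2/2}$ for all $t\in\mathbb{R}$. Graph. $\mathcal{G}(B)$ is the directed graph with vertex set $V$ and edge set $E(B)=\{(k,j):\beta_{jk}\neq 0\}$, where $(k,j)$ is the edge $k\to j$. Define $\zeta=\min_{(k,j)\in E(B)}\beta_{jk}^2$ (if $E(B)=\emptyset$, $\zeta$ may be taken to be any positive number). An ordering $(\theta_1,\dots,\theta_p)$ of $V$ is a topological ordering of $\mathcal{G}(B)$ if for every edge $k\to j$, $k$ appears before $j$ in the ordering. Sample covariance. For i.i.d. copies $X^{(1)},\dots,X^{(n)}$ of $X$ (which is centered), $\hat\Sigma=\frac1n\sum_{i=1}^n X^{(i)}(X^{(i)})^T$. Topological Ordering algorithm with criterion $f$ and input $\hat\Sigma$: set $\Theta^{(0)}=\emptyset$. For $z=1,\dots,p$, choose $\theta_z\in\arg\min_{j\in V\setminus\Theta^{(z-1)}} f(\hat\Sigma,\Theta^{(z-1)},j)$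 (ties broken arbitrarily) and set $\Theta^{(z)}=\Theta^{(z-1)}\cup\{\theta_z\}$. Output the ordered list $(\theta_1,\dots,\theta_p)$. For $\Theta=\emptyset$, $f_1(\hat\Sigma,\emptyset,j)=\hat\Sigma_{j,j}$. If a matrix to be inverted is singular, the criterion may be given an arbitrary value. Subscripts denote submatrices. *)

theory Defs
  imports
    "HOL-Probability.Probability"
    "Jordan_Normal_Form.Spectral_Radius"
    "Jordan_Normal_Form.DL_Submatrix"
    "Jordan_Normal_Form.Gauss_Jordan_Elimination"
begin

text \<open>
  Matrices are zero-based, so the vertex set \<open>{1, \<dots>, p}\<close> becomes \<open>{..<p}\<close>. A random vector is a
  measurable map into the product space \<open>\<real>\<^bsup>p\<^esup>\<close> of functions on \<open>{..<p}\<close>.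
\<close>

abbreviation vec_space :: "nat \<Rightarrow> (nat \<Rightarrow> real) measure" where
  "vec_space p \<equiv> Pi\<^sub>M {..<p} (\<lambda>_. borel)"


subsection \<open>Linear structural equation models with equal error variances\<close>

text \<open>The integrability conditions are needed because a non-integrable function has integral 0.\<close>

definition sub_gaussian :: "'a measure \<Rightarrow> real \<Rightarrow> ('a \<Rightarrow> real) \<Rightarrow> bool" where
  "sub_gaussian M \<gamma> Y \<longleftrightarrow>
     (\<forall>t. integrable M (\<lambda>\<omega>. exp (t * Y \<omega>)) \<and>
          (\<integral>\<omega>. exp (t * Y \<omega>) \<partial>M) \<le> exp (\<gamma>\<^sup>2 * t\<^sup>2 / 2))"

definition equal_var_noise :: "'a measure \<Rightarrow> nat \<Rightarrow> real \<Rightarrow> (nat \<Rightarrow> 'a \<Rightarrow> real) \<Rightarrow> bool" where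
  "equal_var_noise M p \<sigma> \<epsilon> \<longleftrightarrow>
     prob_space.indep_vars M (\<lambda>_. borel) \<epsilon> {..<p} \<and>
     (\<forall>j<p. integrable M (\<epsilon> j) \<and> (\<integral>\<omega>. \<epsilon> j \<omega> \<partial>M) = 0 \<and>
            integrable M (\<lambda>\<omega>. (\<epsilon> j \<omega>)\<^sup>2) \<and> (\<integral>\<omega>. (\<epsilon> j \<omega>)\<^sup>2 \<partial>M) = \<sigma>\<^sup>2)"

definition solves_sem ::
  "'a measure \<Rightarrow> nat \<Rightarrow> real mat \<Rightarrow> ('a \<Rightarrow> nat \<Rightarrow> real) \<Rightarrow> (nat \<Rightarrow> 'a \<Rightarrow> real) \<Rightarrow> bool" where
  "solves_sem M p B X \<epsilon> \<longleftrightarrow>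
     X \<in> M \<rightarrow>\<^sub>M vec_space p \<and>
     (\<forall>j<p. AE \<omega> in M. X \<omega> j = (\<Sum>k\<in>{..<p} - {j}. B $$ (j, k) * X \<omega> k) + \<epsilon> j \<omega>)"

text \<open>\<open>X \<sim> (B, \<sigma>\<^sup>2, \<gamma>)\<close>\<close>

definition sub_gaussian_sem ::
  "'a measure \<Rightarrow> nat \<Rightarrow> real mat \<Rightarrow> real \<Rightarrow> real \<Rightarrow> ('a \<Rightarrow> nat \<Rightarrow> real) \<Rightarrow> bool" where
  "sub_gaussian_sem M p B \<sigma> \<gamma> X \<longleftrightarrow>
     B \<in> carrier_mat p p \<and> (\<forall>j<p. B $$ (j, j) = 0) \<and>
     (\<exists>\<epsilon>. equal_var_noise M p \<sigma> \<epsilon> \<and> solves_sem M p B X \<epsilon> \<and> (\<forall>j<p. sub_gaussian M \<gamma> (\<epsilon> j)))"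


subsection \<open>The graph\<close>

text \<open>The pair \<open>(k, j)\<close> stands for the edge \<open>k \<rightarrow> j\<close>; note the transposed index of \<open>B\<close>.\<close>

definition edges :: "real mat \<Rightarrow> (nat \<times> nat) set" where
  "edges B = {(k, j). k < dim_col B \<and> j < dim_row B \<and> B $$ (j, k) \<noteq> 0}"

definition topological_ordering :: "nat \<Rightarrow> (nat \<times> nat) set \<Rightarrow> nat list \<Rightarrow> bool" where
  "topological_ordering p E \<theta> \<longleftrightarrow>
     distinct \<theta> \<and> set \<theta> = {..<p} \<and>
     (\<forall>(k, j)\<in>E. \<exists>a b. a < b \<and> b < length \<theta> \<and> \<theta> ! a = k \<and> \<theta> ! b = j)"


subsection \<open>Covariance matrices and samples\<close>

text \<open>\<open>\<Sigma> = \<bbbE>(X X\<^sup>T)\<close>\<close>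

definition cov_mat :: "'a measure \<Rightarrow> nat \<Rightarrow> ('a \<Rightarrow> nat \<Rightarrow> real) \<Rightarrow> real mat" where
  "cov_mat M p X = mat p p (\<lambda>(a, b). \<integral>\<omega>. X \<omega> a * X \<omega> b \<partial>M)"

definition sample_cov :: "nat \<Rightarrow> nat \<Rightarrow> (nat \<Rightarrow> nat \<Rightarrow> real) \<Rightarrow> real mat" where
  "sample_cov p n x = mat p p (\<lambda>(a, b). (1 / real n) * (\<Sum>i<n. x i a * x i b))"

definition iid_copies ::
  "'b measure \<Rightarrow> 'a measure \<Rightarrow> nat \<Rightarrow> ('a \<Rightarrow> nat \<Rightarrow> real) \<Rightarrow> nat \<Rightarrow> (nat \<Rightarrow> 'b \<Rightarrow> nat \<Rightarrow> real) \<Rightarrow> bool" where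
  "iid_copies N M p X n Xs \<longleftrightarrow>
     prob_space.indep_vars N (\<lambda>_. vec_space p) Xs {..<n} \<and>
     (\<forall>i<n. distr N (vec_space p) (Xs i) = distr M (vec_space p) X)"


subsection \<open>The Topological Ordering algorithm\<close>

text \<open>The value \<open>u \<Theta> j\<close> is used if \<open>A\<^bsub>\<Theta>,\<Theta>\<^esub>\<close> is singular.\<close>

definition f1 :: "(nat set \<Rightarrow> nat \<Rightarrow> real) \<Rightarrow> real mat \<Rightarrow> nat set \<Rightarrow> nat \<Rightarrow> real" where
  "f1 u A \<Theta> j =
     (case mat_inverse (submatrix A \<Theta> \<Theta>) of
        Some C \<Rightarrow> A $$ (j, j) - (submatrix A {j} \<Theta> * C * submatrix A \<Theta> {j}) $$ (0, 0)
      | None \<Rightarrow> u \<Theta> j)"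

text \<open>
  A relation rather than a function, because ties in the minimisation are broken arbitrarily.
  Before step \<open>z\<close> (counted from 0) the set of chosen vertices is \<open>set (take z \<theta>)\<close>.
\<close>

definition topo_alg_output ::
  "nat \<Rightarrow> (real mat \<Rightarrow> nat set \<Rightarrow> nat \<Rightarrow> real) \<Rightarrow> real mat \<Rightarrow> nat list \<Rightarrow> bool" where
  "topo_alg_output p f A \<theta> \<longleftrightarrow>
     length \<theta> = p \<and>
     (\<forall>z<p. is_arg_min (f A (set (take z \<theta>))) (\<lambda>j. j \<in> {..<p} - set (take z \<theta>)) (\<theta> ! z))"

lemma f1_empty:
  assumes "A \<in> carrier_mat p p" "j < p"
  shows "f1 u A {} j = A $$ (j, j)"
proof -
  let ?S = "submatrix A {} {}"
  have S: "?S \<in> carrier_mat 0 0"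
    by (auto simp: dim_submatrix)
  have "?S \<in> Units (ring_mat TYPE(real) 0 b)" for b :: unit
    using S by (auto simp: Units_def ring_mat_def intro!: bexI[of _ ?S])
  then obtain C where C: "mat_inverse ?S = Some C"
    using mat_inverse(1)[OF S, where b = "()"] by (cases "mat_inverse ?S") auto
  then have "C \<in> carrier_mat 0 0"
    using mat_inverse(2)[OF S] by blast
  moreover have "{i. i < p \<and> i = j} = {j}"
    using assms by auto
  ultimately have "(submatrix A {j} {} * C * submatrix A {} {j}) $$ (0, 0) = 0"
    using assms by (auto simp: dim_submatrix scalar_prod_def)
  then show ?thesis
    by (simp add: f1_def C)
qed

lemma topo_alg_output_exists: "\<exists>\<theta>. topo_alg_output p f A \<theta>"
proof -
  have "\<exists>\<theta>. length \<theta> = m \<and> distinct \<theta> \<and> set \<theta> \<subseteq> {..<p} \<and>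
     (\<forall>z<m. is_arg_min (f A (set (take z \<theta>))) (\<lambda>j. j \<in> {..<p} - set (take z \<theta>)) (\<theta> ! z))"
    if "m \<le> p" for m
    using that
  proof (induction m)
    case 0
    then show ?case by simp
  next
    case (Suc m)
    then obtain \<theta> where \<theta>: "length \<theta> = m" "distinct \<theta>" "set \<theta> \<subseteq> {..<p}"
      "\<forall>z<m. is_arg_min (f A (set (take z \<theta>))) (\<lambda>j. j \<in> {..<p} - set (take z \<theta>)) (\<theta> ! z)"
      by auto
    have "card (set \<theta>) < card {..<p}"
      using \<theta> Suc.prems by (simp add: distinct_card)
    then have "{..<p} - set \<theta> \<noteq> {}"
      using \<theta>(3) by (metis Diff_eq_empty_iff less_irrefl subset_antisym)
    then obtain j where j: "is_arg_min (f A (set \<theta>)) (\<lambda>j. j \<in> {..<p} - set \<theta>) j"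
      using ex_is_arg_min_if_finite[of "{..<p} - set \<theta>" "f A (set \<theta>)"] by auto
    then have "j \<in> {..<p} - set \<theta>"
      by (simp add: is_arg_min_def)
    with \<theta> j show ?case
      by (intro exI[of _ "\<theta> @ [j]"]) (auto simp: nth_append less_Suc_eq)
  qed
  from this[of p] show ?thesis
    by (auto simp: topo_alg_output_def)
qed

end

theory Submission
  imports Defs
begin

text \<open>
  The criterion \<open>f1 A \<Theta> j\<close> is the minimum of the quadratic form \<open>v\<^sup>T A v\<close> over the vectors \<open>v\<close> supported on
  \<open>\<Theta> \<union> {j}\<close> with \<open>v\<^sub>j = 1\<close>. For the true covariance, \<open>v\<^sup>T \<Sigma> v = \<sigma>\<^sup>2 |u|\<^sup>2\<close>, where \<open>u\<close> are the coefficients of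
  \<open>v\<^sup>T X\<close> in the noise variables. If \<open>\<Theta>\<close> is closed under parents, this gives the value \<open>\<sigma>\<^sup>2\<close> when all
  parents of \<open>j\<close> lie in \<open>\<Theta>\<close>, and at least \<open>\<sigma>\<^sup>2 (1 + \<zeta>)\<close>, hence at least \<open>\<sigma>\<^sup>2 + \<zeta> \<lambda>\<close> with \<open>\<lambda>\<close> the least
  eigenvalue, otherwise.
  If all entries of \<open>A - \<Sigma>\<close> are below \<open>\<delta>\<close>, then \<open>v\<^sup>T A v\<close> and \<open>v\<^sup>T \<Sigma> v\<close> differ at most by the factor
  \<open>1 \<plusminus> p \<delta> / \<lambda>\<close>, so the two cases stay separated for \<open>\<delta> \<le> \<zeta> \<lambda>\<^sup>2 / (p (\<zeta> \<lambda> + 2 \<sigma>\<^sup>2))\<close>, and every step of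
  the algorithm extends a set closed under parents by a vertex whose parents have been chosen already.
  The entries of the sample covariance are averages of products of sub-Gaussian variables, which obey
  a Chernoff bound; a union bound over the \<open>p\<^sup>2\<close> entries concludes.
\<close>

subsection \<open>Quadratic forms and the least eigenvalue\<close>

text \<open>Vectors are total functions of which only the values below \<open>p\<close> are read, so
  shifting one coordinate or padding by zeros needs no dimension conditions.\<close>

definition mat_fun :: "nat \<Rightarrow> real mat \<Rightarrow> (nat \<Rightarrow> real) \<Rightarrow> nat \<Rightarrow> real" where
  "mat_fun p A v a = (\<Sum>b<p. A $$ (a, b) * v b)"

definition quad_form :: "nat \<Rightarrow> real mat \<Rightarrow> (nat \<Rightarrow> real) \<Rightarrow> real" where
  "quad_form p A v = (\<Sum>a<p. v a * mat_fun p A v a)"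

definition sym_on :: "nat \<Rightarrow> real mat \<Rightarrow> bool" where
  "sym_on p A \<longleftrightarrow> (\<forall>a<p. \<forall>b<p. A $$ (a, b) = A $$ (b, a))"

lemma quad_form_altdef: "quad_form p A v = (\<Sum>a<p. \<Sum>b<p. A $$ (a, b) * v a * v b)"
  by (simp add: quad_form_def mat_fun_def sum_distrib_left algebra_simps)

lemma mat_fun_add_scale: "mat_fun p A (\<lambda>i. v i + t * w i) a = mat_fun p A v a + t * mat_fun p A w a"
  by (simp add: mat_fun_def sum_distrib_left algebra_simps sum.distrib)

lemma sum_mat_fun_sym:
  assumes "sym_on p A"
  shows "(\<Sum>a<p. v a * mat_fun p A w a) = (\<Sum>a<p. w a * mat_fun p A v a)"
proof -
  have "(\<Sum>a<p. v a * mat_fun p A w a) = (\<Sum>a<p. \<Sum>b<p. v a * (A $$ (a, b) * w b))"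
    by (simp add: mat_fun_def sum_distrib_left)
  also have "\<dots> = (\<Sum>b<p. \<Sum>a<p. v a * (A $$ (a, b) * w b))"
    by (rule sum.swap)
  also have "\<dots> = (\<Sum>b<p. \<Sum>a<p. w b * (A $$ (b, a) * v a))"
    using assms by (intro sum.cong) (auto simp: sym_on_def)
  finally show ?thesis
    by (simp add: mat_fun_def sum_distrib_left)
qed

lemma quad_form_add_scale:
  assumes "sym_on p A"
  shows "quad_form p A (\<lambda>i. v i + t * w i) =
    quad_form p A v + 2 * t * (\<Sum>a<p. w a * mat_fun p A v a) + t\<^sup>2 * quad_form p A w"
proof -
  have "quad_form p A (\<lambda>i. v i + t * w i) =
     (\<Sum>a<p. v a * mat_fun p A v a) + t * (\<Sum>a<p. v a * mat_fun p A w a)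
     + t * (\<Sum>a<p. w a * mat_fun p A v a) + t\<^sup>2 * (\<Sum>a<p. w a * mat_fun p A w a)"
    unfolding quad_form_def mat_fun_add_scale
    by (simp add: sum_distrib_left algebra_simps sum.distrib power2_eq_square)
  then show ?thesis
    using sum_mat_fun_sym[OF assms, of v w] by (simp add: quad_form_def)
qed

lemma quad_form_scale: "quad_form p A (\<lambda>i. c * v i) = c\<^sup>2 * quad_form p A v"
  by (simp add: quad_form_def mat_fun_def sum_distrib_left algebra_simps power2_eq_square)

lemma quad_form_cong: "(\<And>i. i < p \<Longrightarrow> v i = w i) \<Longrightarrow> quad_form p A v = quad_form p A w"
  by (simp add: quad_form_def mat_fun_def)

lemma quad_form_unit:
  assumes "a < p"
  shows "quad_form p A (\<lambda>i. if i = a then 1 else 0) = A $$ (a, a)"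
  using assms by (simp add: quad_form_def mat_fun_def if_distrib if_distribR cong: if_cong)

lemma sym_on_sub_scalar:
  assumes "A \<in> carrier_mat p p" "sym_on p A"
  shows "sym_on p (A - c \<cdot>\<^sub>m 1\<^sub>m p)"
  using assms by (auto simp: sym_on_def)

lemma mat_fun_sub_scalar:
  assumes "A \<in> carrier_mat p p" "a < p"
  shows "mat_fun p (A - c \<cdot>\<^sub>m 1\<^sub>m p) v a = mat_fun p A v a - c * v a"
proof -
  have "mat_fun p (A - c \<cdot>\<^sub>m 1\<^sub>m p) v a =
    (\<Sum>b<p. A $$ (a, b) * v b - (if a = b then c * v b else 0))"
    unfolding mat_fun_def using assms by (intro sum.cong) (auto simp: algebra_simps)
  then show ?thesis
    using assms by (simp add: sum_subtractf mat_fun_def)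
qed

lemma quad_form_sub_scalar:
  assumes "A \<in> carrier_mat p p"
  shows "quad_form p (A - c \<cdot>\<^sub>m 1\<^sub>m p) v = quad_form p A v - c * (\<Sum>i<p. (v i)\<^sup>2)"
  using assms by (simp add: quad_form_def mat_fun_sub_scalar algebra_simps sum_subtractf
      sum_distrib_left power2_eq_square)

section \<open>First-order conditions and the Rayleigh quotient\<close>

lemma quadratic_nonneg_imp_linear_coeff_zero:
  fixes b c :: real
  assumes "\<And>t. 0 \<le> 2 * t * b + t\<^sup>2 * c"
  shows "b = 0"
proof (rule ccontr)
  assume "b \<noteq> 0"
  define C where "C = \<bar>c\<bar> + 1"
  have C: "C > 0" "c < C" by (auto simp: C_def)
  \<comment> \<open>At t = - b / C the linear term wins because c < C; the summand 1 in
    \<open>C\<close> keeps the quotient meaningful when c = 0.\<close>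
  have "0 \<le> 2 * (- b / C) * b + (- b / C)\<^sup>2 * c" by (rule assms)
  also have "\<dots> = b\<^sup>2 / C\<^sup>2 * (c - 2 * C)"
    using C by (simp add: field_simps power2_eq_square)
  also have "\<dots> < 0"
    using C \<open>b \<noteq> 0\<close> by (intro mult_pos_neg) auto
  finally show False by simp
qed

text \<open>A null vector minimises a nonnegative form, so its first variation vanishes in every
  direction; along the unit vector at \<open>a\<close> that variation is twice
  \<open>mat_fun p A v a\<close>.\<close>

lemma psd_null_imp_kernel:
  assumes "sym_on p A" "\<And>w. 0 \<le> quad_form p A w" "quad_form p A v = 0" "a < p"
  shows "mat_fun p A v a = 0"
proof (rule quadratic_nonneg_imp_linear_coeff_zero)
  fix t
  let ?e = "\<lambda>i. if i = a then 1 else (0::real)"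
  have "0 \<le> quad_form p A (\<lambda>i. v i + t * ?e i)" by (rule assms)
  also have "\<dots> = 2 * t * (\<Sum>i<p. ?e i * mat_fun p A v i) + t\<^sup>2 * quad_form p A ?e"
    unfolding quad_form_add_scale[OF assms(1)] assms(3) by (rule arg_cong2[of _ _ _ _ "(+)"]) auto
  also have "(\<Sum>i<p. ?e i * mat_fun p A v i) = mat_fun p A v a"
    using assms(4) by (simp add: if_distrib if_distribR cong: if_cong)
  finally show "0 \<le> 2 * t * mat_fun p A v a + t\<^sup>2 * quad_form p A ?e" .
qed

text \<open>A closed subset of the cube of all functions into [-1, 1], which is compact by
  Tychonoff. Fixing the coordinates from \<open>p\<close> on to 0 places the sphere inside that
  cube.\<close>

lemma compact_unit_sphere_fun: "compact {v::nat \<Rightarrow> real. (\<forall>i\<ge>p. v i = 0) \<and> (\<Sum>i<p. (v i)\<^sup>2) = 1}"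
proof -
  let ?K = "{v::nat \<Rightarrow> real. (\<forall>i\<ge>p. v i = 0) \<and> (\<Sum>i<p. (v i)\<^sup>2) = 1}"
  let ?C = "PiE UNIV (\<lambda>_::nat. {-1..1::real})"
  have "compactin (product_topology (\<lambda>_. euclidean) UNIV) ?C"
    unfolding compactin_PiE by auto
  then have "compact ?C"
    by (simp add: euclidean_product_topology)
  have coord: "continuous_on UNIV (\<lambda>v::nat \<Rightarrow> real. v i)" for i by simp
  have "closed (\<Inter>i\<in>{p..}. {v::nat \<Rightarrow> real. v i = 0})"
    by (intro closed_INT ballI closed_Collect_eq coord) auto
  moreover have "closed {v::nat \<Rightarrow> real. (\<Sum>i<p. (v i)\<^sup>2) = 1}"
    by (intro closed_Collect_eq continuous_intros coord)
  ultimately have "closed ((\<Inter>i\<in>{p..}. {v::nat \<Rightarrow> real. v i = 0}) \<inter> {v. (\<Sum>i<p. (v i)\<^sup>2) = 1})"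
    by (rule closed_Int)
  also have "(\<Inter>i\<in>{p..}. {v::nat \<Rightarrow> real. v i = 0}) \<inter> {v. (\<Sum>i<p. (v i)\<^sup>2) = 1} = ?K" by auto
  finally have "closed ?K" .
  have "?K \<subseteq> ?C"
  proof safe
    fix v :: "nat \<Rightarrow> real" and i
    assume v: "\<forall>i\<ge>p. v i = 0" "(\<Sum>i<p. (v i)\<^sup>2) = 1"
    have "(v i)\<^sup>2 \<le> 1"
    proof (cases "i < p")
      case True
      then have "(v i)\<^sup>2 \<le> (\<Sum>i<p. (v i)\<^sup>2)" by (intro member_le_sum) auto
      with v show ?thesis by simp
    qed (use v in auto)
    then show "v i \<in> {-1..1}"
      by (auto simp: abs_square_le_1 abs_le_iff)
  qed auto
  then have "?C \<inter> ?K = ?K" by (rule Int_absorb1)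
  then show ?thesis
    using compact_Int_closed[OF \<open>compact ?C\<close> \<open>closed ?K\<close>] by simp
qed

text \<open>Rayleigh's argument: the form attains a minimum \<mu> on the sphere. After subtracting
  \<mu> times the identity, the form is nonnegative and the minimiser is a null vector, hence in the
  kernel. So \<mu> is an eigenvalue, and it bounds the form from below by homogeneity.\<close>

lemma Min_spectrum_le_quad_form:
  assumes A: "A \<in> carrier_mat p p" and sym: "sym_on p A"
  shows "Min (spectrum A) * (\<Sum>i<p. (w i)\<^sup>2) \<le> quad_form p A w"
proof (cases "p = 0")
  \<comment> \<open>In dimension 0 the spectrum is empty and its \<open>Min\<close> unspecified, but
    both sides are 0.\<close>
  case True
  then show ?thesis by (simp add: quad_form_def)
next
  case False
  let ?K = "{v::nat \<Rightarrow> real. (\<forall>i\<ge>p. v i = 0) \<and> (\<Sum>i<p. (v i)\<^sup>2) = 1}"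
  have "(\<lambda>i. if i = 0 then 1 else 0) \<in> ?K"
    using False by (auto simp: if_distrib if_distribR power2_eq_square cong: if_cong)
  then have "?K \<noteq> {}" by (rule ex_in_conv[THEN iffD1, OF exI])
  have coord: "continuous_on K (\<lambda>v::nat \<Rightarrow> real. v i)" for i K
    by (rule continuous_on_subset[of UNIV]) auto
  have "continuous_on ?K (quad_form p A)"
    unfolding quad_form_altdef by (intro continuous_on_sum continuous_on_mult continuous_on_const coord)
  then obtain v where v: "v \<in> ?K" "\<And>w. w \<in> ?K \<Longrightarrow> quad_form p A v \<le> quad_form p A w"
    using continuous_attains_inf[OF compact_unit_sphere_fun \<open>?K \<noteq> {}\<close>
        \<open>continuous_on ?K (quad_form p A)\<close>] by (elim bexE) (rule that, assumption, drule bspec)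
  define \<mu> where "\<mu> = quad_form p A v"
  have ge: "\<mu> * (\<Sum>i<p. (w i)\<^sup>2) \<le> quad_form p A w" for w
  proof (cases "(\<Sum>i<p. (w i)\<^sup>2) = 0")
    case True
    then have "\<And>i. i < p \<Longrightarrow> w i = 0" by (subst (asm) sum_nonneg_eq_0_iff) auto
    then show ?thesis by (simp add: quad_form_def)
  next
    case False
    define s where "s = sqrt (\<Sum>i<p. (w i)\<^sup>2)"
    have s2: "s\<^sup>2 = (\<Sum>i<p. (w i)\<^sup>2)"
      unfolding s_def by (simp add: sum_nonneg)
    then have "s \<noteq> 0" using False by auto
    let ?w = "\<lambda>i. if i < p then (1 / s) * w i else 0"
    have "(\<Sum>i<p. (?w i)\<^sup>2) = (1 / s)\<^sup>2 * (\<Sum>i<p. (w i)\<^sup>2)"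
      by (simp add: sum_distrib_left power_mult_distrib power_divide)
    also have "\<dots> = 1"
      using \<open>s \<noteq> 0\<close> by (simp add: s2[symmetric] power_divide)
    finally have "?w \<in> ?K" by simp
    then have "\<mu> \<le> quad_form p A ?w"
      unfolding \<mu>_def by (rule v)
    also have "\<dots> = quad_form p A (\<lambda>i. (1 / s) * w i)"
      by (rule quad_form_cong) auto
    also have "\<dots> = (1 / s)\<^sup>2 * quad_form p A w"
      by (rule quad_form_scale)
    finally show ?thesis
      using \<open>s \<noteq> 0\<close> by (simp add: s2[symmetric] field_simps)
  qed
  let ?A' = "A - \<mu> \<cdot>\<^sub>m 1\<^sub>m p"
  have ker: "mat_fun p ?A' v a = 0" if "a < p" for a
  proof (rule psd_null_imp_kernel[OF sym_on_sub_scalar[OF A sym] _ _ that])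
    show "0 \<le> quad_form p ?A' w" for w
      using ge[of w] by (simp add: quad_form_sub_scalar[OF A])
    show "quad_form p ?A' v = 0"
      using v(1) by (simp add: quad_form_sub_scalar[OF A] \<mu>_def)
  qed
  have "eigenvector A (vec p v) \<mu>"
    unfolding eigenvector_def
  proof (intro conjI)
    show "vec p v \<in> carrier_vec (dim_row A)" using A by auto
    show "vec p v \<noteq> 0\<^sub>v (dim_row A)"
    proof
      assume "vec p v = 0\<^sub>v (dim_row A)"
      then have "v i = 0" if "i < p" for i
        using that A by (metis carrier_matD(1) index_vec index_zero_vec(1))
      with v(1) show False by simp
    qed
    show "A *\<^sub>v vec p v = \<mu> \<cdot>\<^sub>v vec p v"
    proof (rule eq_vecI)
      fix i assume "i < dim_vec (\<mu> \<cdot>\<^sub>v vec p v)"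
      then have i: "i < p" by simp
      have "(A *\<^sub>v vec p v) $ i = mat_fun p A v i"
        using A i by (simp add: mat_fun_def scalar_prod_def lessThan_atLeast0)
      also have "\<dots> = \<mu> * v i"
        using ker[OF i] by (simp add: mat_fun_sub_scalar[OF A i])
      finally show "(A *\<^sub>v vec p v) $ i = (\<mu> \<cdot>\<^sub>v vec p v) $ i"
        using i by simp
    qed (use A in auto)
  qed
  then have "\<mu> \<in> spectrum A"
    by (auto simp: spectrum_def eigenvalue_def)
  then have "Min (spectrum A) \<le> \<mu>"
    using card_finite_spectrum(1)[OF A] by simp
  then have "Min (spectrum A) * (\<Sum>i<p. (w i)\<^sup>2) \<le> \<mu> * (\<Sum>i<p. (w i)\<^sup>2)"
    by (intro mult_right_mono sum_nonneg) auto
  with ge[of w] show ?thesis by linarith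
qed

subsection \<open>The criterion as a minimum of the quadratic form\<close>

definition pos_def_on :: "nat \<Rightarrow> real mat \<Rightarrow> bool" where
  "pos_def_on p A \<longleftrightarrow> (\<forall>v. (\<exists>i<p. v i \<noteq> 0) \<longrightarrow> quad_form p A v > 0)"

lemma pos_def_on_imp_nonneg:
  assumes "pos_def_on p A"
  shows "0 \<le> quad_form p A v"
proof (cases "\<exists>i<p. v i \<noteq> 0")
  case True
  with assms show ?thesis by (auto simp: pos_def_on_def intro: less_imp_le)
next
  case False
  then show ?thesis by (simp add: quad_form_def)
qed

text \<open>\<open>submatrix\<close> numbers its rows and columns through \<open>pick\<close>, the
  increasing enumeration; counting the smaller elements inverts it.\<close>

lemma bij_betw_pick:
  assumes "finite S"
  shows "bij_betw (pick S) {..<card S} S"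
proof -
  have "inj_on (pick S) {..<card S}"
    by (rule inj_on_inverseI[where g = "\<lambda>i. card {a \<in> S. a < i}"]) (simp add: card_pick_le)
  moreover have "pick S ` {..<card S} \<subseteq> S"
    by (auto intro: pick_in_set_le)
  ultimately show ?thesis
    using assms by (simp add: bij_betw_def card_image card_subset_eq)
qed

text \<open>The cardinality is the position of \<open>i\<close> in \<Theta>, so this carries a
  vector indexed like \<open>submatrix A \<Theta> \<Theta>\<close> back to the full index set,
  padded by zeros.\<close>

definition extend_vec :: "nat set \<Rightarrow> (nat \<Rightarrow> real) \<Rightarrow> nat \<Rightarrow> real" where
  "extend_vec \<Theta> x i = (if i \<in> \<Theta> then x (card {a \<in> \<Theta>. a < i}) else 0)"

lemma mat_fun_extend_vec:
  assumes "\<Theta> \<subseteq> {..<p}"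
  shows "mat_fun p A (extend_vec \<Theta> x) c = (\<Sum>a<card \<Theta>. A $$ (c, pick \<Theta> a) * x a)"
proof -
  have fin: "finite \<Theta>" using assms finite_subset by blast
  have "mat_fun p A (extend_vec \<Theta> x) c = (\<Sum>b\<in>\<Theta>. A $$ (c, b) * extend_vec \<Theta> x b)"
    unfolding mat_fun_def using assms by (intro sum.mono_neutral_right) (auto simp: extend_vec_def)
  also have "\<dots> = (\<Sum>a<card \<Theta>. A $$ (c, pick \<Theta> a) * extend_vec \<Theta> x (pick \<Theta> a))"
    by (rule sum.reindex_bij_betw[OF bij_betw_pick[OF fin], symmetric])
  also have "\<dots> = (\<Sum>a<card \<Theta>. A $$ (c, pick \<Theta> a) * x a)"
    by (intro sum.cong) (auto simp: extend_vec_def card_pick_le pick_in_set_le)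
  finally show ?thesis .
qed

lemma mat_mult_nth:
  assumes "P \<in> carrier_mat m r" "Q \<in> carrier_mat r n" "a < m" "b < n"
  shows "(P * Q) $$ (a, b) = (\<Sum>c<r. P $$ (a, c) * Q $$ (c, b))"
  using assms by (simp add: scalar_prod_def lessThan_atLeast0)

lemma submatrix_carrier:
  assumes "A \<in> carrier_mat p p" "I \<subseteq> {..<p}" "J \<subseteq> {..<p}"
  shows "submatrix A I J \<in> carrier_mat (card I) (card J)"
proof -
  have "{i. i < p \<and> i \<in> I} = I" "{i. i < p \<and> i \<in> J} = J" using assms by auto
  then show ?thesis using assms by (auto simp: dim_submatrix)
qed

lemma submatrix_nth:
  assumes "A \<in> carrier_mat p p" "I \<subseteq> {..<p}" "J \<subseteq> {..<p}" "a < card I" "b < card J"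
  shows "submatrix A I J $$ (a, b) = A $$ (pick I a, pick J b)"
proof -
  have "{i. i < p \<and> i \<in> I} = I" "{i. i < p \<and> i \<in> J} = J" using assms by auto
  then show ?thesis using assms by (intro submatrix_index) auto
qed

text \<open>A kernel vector of the submatrix, padded by zeros, would be a nonzero null vector of the
  whole form. Hence \<open>f1\<close> takes its regular value and never the arbitrary one.\<close>

lemma mat_inverse_principal_submatrix:
  assumes A: "A \<in> carrier_mat p p" and pd: "pos_def_on p A" and \<Theta>: "\<Theta> \<subseteq> {..<p}"
  obtains C where "mat_inverse (submatrix A \<Theta> \<Theta>) = Some C"
proof -
  let ?S = "submatrix A \<Theta> \<Theta>" and ?r = "card \<Theta>"
  have S: "?S \<in> carrier_mat ?r ?r" by (rule submatrix_carrier[OF A \<Theta> \<Theta>])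
  have fin: "finite \<Theta>" using \<Theta> finite_subset by blast
  have "det ?S \<noteq> 0"
  proof
    assume "det ?S = 0"
    then obtain x where x: "x \<in> carrier_vec ?r" "x \<noteq> 0\<^sub>v ?r" "?S *\<^sub>v x = 0\<^sub>v ?r"
      using det_0_iff_vec_prod_zero_field[OF S] by auto
    let ?w = "extend_vec \<Theta> (vec_index x)"
    have "mat_fun p A ?w (pick \<Theta> c) = 0" if "c < ?r" for c
    proof -
      have "mat_fun p A ?w (pick \<Theta> c) = (?S *\<^sub>v x) $ c"
        using that S x(1) by (simp add: mat_fun_extend_vec[OF \<Theta>] scalar_prod_def lessThan_atLeast0
            submatrix_nth[OF A \<Theta> \<Theta>])
      then show ?thesis using that x(3) by simp
    qed
    then have "mat_fun p A ?w i = 0" if "i \<in> \<Theta>" for i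
      using that bij_betw_imp_surj_on[OF bij_betw_pick[OF fin]] by (metis image_iff lessThan_iff)
    then have "?w i * mat_fun p A ?w i = 0" for i
      by (cases "i \<in> \<Theta>") (auto simp: extend_vec_def)
    then have "quad_form p A ?w = 0"
      by (simp add: quad_form_def)
    moreover obtain c where c: "c < ?r" "x $ c \<noteq> 0"
      using x(1,2) by (metis carrier_vecD eq_vecI index_zero_vec(1) index_zero_vec(2))
    then have "?w (pick \<Theta> c) \<noteq> 0" "pick \<Theta> c < p"
      using pick_in_set_le[OF c(1)] \<Theta> by (auto simp: extend_vec_def card_pick_le)
    ultimately show False
      using pd by (metis less_irrefl pos_def_on_def)
  qed
  then have "?S \<in> Units (ring_mat TYPE(real) ?r ())"
    by (rule det_non_zero_imp_unit[OF S])
  then obtain C where "mat_inverse ?S = Some C"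
    using mat_inverse(1)[OF S, where b = "()"] by (cases "mat_inverse ?S") auto
  then show ?thesis by (rule that)
qed

text \<open>The minimiser is the vector of residual coefficients of the regression of \<open>j\<close> on \<open>\<Theta>\<close>.\<close>

lemma f1_eq_quad_form:
  assumes A: "A \<in> carrier_mat p p" and pd: "pos_def_on p A"
    and \<Theta>: "\<Theta> \<subseteq> {..<p}" and j: "j < p" "j \<notin> \<Theta>"
  obtains v where "v j = 1" "\<And>i. i \<notin> insert j \<Theta> \<Longrightarrow> v i = 0"
    "\<And>i. i \<in> \<Theta> \<Longrightarrow> mat_fun p A v i = 0" "f1 u A \<Theta> j = quad_form p A v"
proof -
  let ?S = "submatrix A \<Theta> \<Theta>" and ?r = "card \<Theta>"
  let ?D = "submatrix A \<Theta> {j}" and ?E = "submatrix A {j} \<Theta>"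
  have J: "{j} \<subseteq> {..<p}" using j by simp
  have fin: "finite \<Theta>" using \<Theta> finite_subset by blast
  have S: "?S \<in> carrier_mat ?r ?r" by (rule submatrix_carrier[OF A \<Theta> \<Theta>])
  have D: "?D \<in> carrier_mat ?r 1" using submatrix_carrier[OF A \<Theta> J] by simp
  have E: "?E \<in> carrier_mat 1 ?r" using submatrix_carrier[OF A J \<Theta>] by simp
  obtain C where C: "mat_inverse ?S = Some C"
    using mat_inverse_principal_submatrix[OF A pd \<Theta>] .
  have SC: "?S * C = 1\<^sub>m ?r" and Cc: "C \<in> carrier_mat ?r ?r"
    using mat_inverse(2)[OF S C] by auto
  \<comment> \<open>\<open>y\<close> holds the regression coefficients of \<open>j\<close> on
    \<Theta>, and \<open>v\<close> is the unit vector at \<open>j\<close> minus their zero-padded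
    version.\<close>
  define y where "y a = (C * ?D) $$ (a, 0)" for a
  define w where "w = extend_vec \<Theta> y"
  define v where "v i = (if i = j then 1 else 0) + (- 1) * w i" for i
  have pickj: "pick {j} 0 = j" using pick_in_set_le[of 0 "{j}"] by simp
  have CD: "C * ?D \<in> carrier_mat ?r 1" using Cc D by simp
  have mv: "mat_fun p A v c = A $$ (c, j) - (\<Sum>a<?r. A $$ (c, pick \<Theta> a) * y a)" for c
  proof -
    have "mat_fun p A v c = mat_fun p A (\<lambda>i. if i = j then 1 else 0) c + (- 1) * mat_fun p A w c"
      unfolding v_def by (rule mat_fun_add_scale)
    also have "mat_fun p A (\<lambda>i. if i = j then 1 else 0) c = A $$ (c, j)"
      using j by (simp add: mat_fun_def if_distrib cong: if_cong)
    finally show ?thesis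
      by (simp add: w_def mat_fun_extend_vec[OF \<Theta>])
  qed
  have ker: "mat_fun p A v i = 0" if "i \<in> \<Theta>" for i
  proof -
    have "i \<in> pick \<Theta> ` {..<?r}"
      using that bij_betw_imp_surj_on[OF bij_betw_pick[OF fin]] by (simp only:)
    then obtain c where c: "c < ?r" "i = pick \<Theta> c"
      by (elim imageE) (simp only: lessThan_iff)
    have "(?S * (C * ?D)) $$ (c, 0) = (\<Sum>a<?r. ?S $$ (c, a) * y a)"
      unfolding y_def using S CD c(1) by (rule mat_mult_nth) simp
    also have "\<dots> = (\<Sum>a<?r. A $$ (i, pick \<Theta> a) * y a)"
      using submatrix_nth[OF A \<Theta> \<Theta>, of c] c by simp
    finally have "(\<Sum>a<?r. A $$ (i, pick \<Theta> a) * y a) = (?S * (C * ?D)) $$ (c, 0)" ..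
    also have "?S * (C * ?D) = ?D"
      using S Cc D SC by (simp add: assoc_mult_mat[symmetric])
    also have "?D $$ (c, 0) = A $$ (i, j)"
      using submatrix_nth[OF A \<Theta> J, of c 0] c pickj by (simp del: pick.simps)
    finally show ?thesis by (simp add: mv)
  qed
  have wj: "w j = 0" using j by (simp add: w_def extend_vec_def)
  have vj: "v j = 1" by (simp add: v_def wj)
  have v0: "v i = 0" if "i \<notin> insert j \<Theta>" for i
    using that by (simp add: v_def w_def extend_vec_def)
  \<comment> \<open>The normal equations \<open>ker\<close> remove the terms in \<Theta>, leaving
    the single row \<open>j\<close>, which is the formula of the criterion.\<close>
  have "quad_form p A v = (\<Sum>i\<in>{j}. v i * mat_fun p A v i)"
    unfolding quad_form_def using j ker v0 by (intro sum.mono_neutral_right) auto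
  also have "\<dots> = A $$ (j, j) - (\<Sum>a<?r. A $$ (j, pick \<Theta> a) * y a)"
    by (simp add: vj mv)
  also have "(\<Sum>a<?r. A $$ (j, pick \<Theta> a) * y a) = (?E * (C * ?D)) $$ (0, 0)"
  proof -
    have "(?E * (C * ?D)) $$ (0, 0) = (\<Sum>a<?r. ?E $$ (0, a) * y a)"
      unfolding y_def using E CD by (rule mat_mult_nth) simp_all
    then show ?thesis
      using submatrix_nth[OF A J \<Theta>, of 0] pickj by (simp del: pick.simps)
  qed
  also have "?E * (C * ?D) = ?E * C * ?D"
    using E Cc D by (simp add: assoc_mult_mat)
  finally have "f1 u A \<Theta> j = quad_form p A v"
    by (simp add: f1_def C)
  with vj v0 ker show ?thesis by (rule that)
qed

text \<open>A competitor differs from the minimiser \<open>v\<close> by a vector supported on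
  \<Theta>, where \<open>mat_fun p A v\<close> vanishes. The cross term disappears and the form of
  the difference is nonnegative.\<close>

lemma f1_le_quad_form:
  assumes A: "A \<in> carrier_mat p p" and sym: "sym_on p A" and pd: "pos_def_on p A"
    and \<Theta>: "\<Theta> \<subseteq> {..<p}" and j: "j < p" "j \<notin> \<Theta>"
    and w: "w j = 1" "\<And>i. i < p \<Longrightarrow> i \<notin> insert j \<Theta> \<Longrightarrow> w i = 0"
  shows "f1 u A \<Theta> j \<le> quad_form p A w"
proof -
  obtain v where v: "v j = 1" "\<And>i. i \<notin> insert j \<Theta> \<Longrightarrow> v i = 0"
    "\<And>i. i \<in> \<Theta> \<Longrightarrow> mat_fun p A v i = 0" "f1 u A \<Theta> j = quad_form p A v"
    by (rule f1_eq_quad_form[OF A pd \<Theta> j, of u]) blast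
  let ?d = "\<lambda>i. w i - v i"
  have "?d a * mat_fun p A v a = 0" if "a < p" for a
    using v w that by (cases "a = j"; cases "a \<in> \<Theta>") auto
  then have "(\<Sum>a<p. ?d a * mat_fun p A v a) = 0" by (intro sum.neutral) blast
  then have "quad_form p A w = quad_form p A v + quad_form p A ?d"
    using quad_form_add_scale[OF sym, of v 1 ?d] by simp
  with pos_def_on_imp_nonneg[OF pd, of ?d] v(4) show ?thesis by linarith
qed

subsection \<open>Noise coefficients\<close>

text \<open>The rank is the number of proper ancestors. It grows along k \<rightarrow> j because k
  is an ancestor of j but, by acyclicity, not of itself. It supports the inductions along the graph
  below.\<close>

lemma acyclic_finite_rank:
  assumes "acyclic E" "finite E"
  obtains r :: "nat \<Rightarrow> nat" where "\<And>k j. (k, j) \<in> E \<Longrightarrow> r k < r j"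
proof -
  have fin: "finite {a. (a, k) \<in> E\<^sup>+}" for k
  proof (rule finite_subset)
    show "{a. (a, k) \<in> E\<^sup>+} \<subseteq> fst ` E"
      by (metis (no_types, lifting) fst_conv image_eqI mem_Collect_eq subsetI tranclD)
  qed (use assms in simp)
  have "card {a. (a, k) \<in> E\<^sup>+} < card {a. (a, j) \<in> E\<^sup>+}" if "(k, j) \<in> E" for k j
  proof (rule psubset_card_mono[OF fin])
    have "{a. (a, k) \<in> E\<^sup>+} \<subseteq> {a. (a, j) \<in> E\<^sup>+}"
      using that by (auto intro: trancl_into_trancl)
    moreover have "k \<in> {a. (a, j) \<in> E\<^sup>+} - {a. (a, k) \<in> E\<^sup>+}"
      using that assms(1) by (auto simp: acyclic_def)
    ultimately show "{a. (a, k) \<in> E\<^sup>+} \<subset> {a. (a, j) \<in> E\<^sup>+}" by blast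
  qed
  then show ?thesis by (rule that)
qed

lemma edges_iff: "B \<in> carrier_mat p p \<Longrightarrow> (k, j) \<in> edges B \<longleftrightarrow> k < p \<and> j < p \<and> B $$ (j, k) \<noteq> 0"
  by (auto simp: edges_def)

lemma finite_edges: "finite (edges B)"
  by (rule finite_subset[of _ "{..<dim_col B} \<times> {..<dim_row B}"]) (auto simp: edges_def)

text \<open>Coefficients with \<open>\<Sum>\<^sub>k v\<^sub>k X\<^sub>k = \<Sum>\<^sub>j u\<^sub>j \<epsilon>\<^sub>j\<close>, that is \<open>(I - B)\<^sup>T u = v\<close>.\<close>

definition noise_coeffs :: "nat \<Rightarrow> real mat \<Rightarrow> (nat \<Rightarrow> real) \<Rightarrow> (nat \<Rightarrow> real) \<Rightarrow> bool" where
  "noise_coeffs p B v u \<longleftrightarrow> (\<forall>k<p. u k = v k + (\<Sum>c<p. B $$ (c, k) * u c))"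

text \<open>Back substitution against the edges: \<open>u k\<close> depends only on the children of
  \<open>k\<close>, which have larger rank. At stage \<open>m\<close> the equations hold at all
  vertices of rank at least R - m.\<close>

lemma noise_coeffs_exist:
  assumes B: "B \<in> carrier_mat p p" and ac: "acyclic (edges B)"
  obtains u where "noise_coeffs p B v u"
proof -
  obtain r :: "nat \<Rightarrow> nat" where r: "\<And>k j. (k, j) \<in> edges B \<Longrightarrow> r k < r j"
    using acyclic_finite_rank[OF ac finite_edges] by blast
  define R where "R = Suc (\<Sum>k<p. r k)"
  have R: "r k < R" if "k < p" for k
    using member_le_sum[of k "{..<p}" r] that by (auto simp: R_def)
  have "\<exists>u. \<forall>k<p. R \<le> r k + m \<longrightarrow> u k = v k + (\<Sum>c<p. B $$ (c, k) * u c)" for m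
  proof (induction m)
    case 0
    then show ?case using R by (auto simp: not_le[symmetric])
  next
    case (Suc m)
    then obtain u where u: "\<forall>k<p. R \<le> r k + m \<longrightarrow> u k = v k + (\<Sum>c<p. B $$ (c, k) * u c)" by blast
    \<comment> \<open>Only vertices below the solved ranks change. The children of a vertex on the
      new level are already solved, so its equation sees the old values.\<close>
    define u' where "u' k = (if R \<le> r k + m then u k else v k + (\<Sum>c<p. B $$ (c, k) * u c))" for k
    have "u' k = v k + (\<Sum>c<p. B $$ (c, k) * u' c)" if k: "k < p" "R \<le> r k + Suc m" for k
    proof -
      have "(\<Sum>c<p. B $$ (c, k) * u' c) = (\<Sum>c<p. B $$ (c, k) * u c)"
      proof (intro sum.cong refl)
        fix c assume "c \<in> {..<p}"
        then have "R \<le> r c + m" if "B $$ (c, k) \<noteq> 0"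
          using r[of k c] that k by (simp add: edges_iff[OF B])
        then show "B $$ (c, k) * u' c = B $$ (c, k) * u c"
          by (auto simp: u'_def)
      qed
      then show ?thesis using u k by (auto simp: u'_def)
    qed
    then show ?case by blast
  qed
  from this[of R] obtain u where "\<forall>k<p. R \<le> r k + R \<longrightarrow> u k = v k + (\<Sum>c<p. B $$ (c, k) * u c)" ..
  then have "noise_coeffs p B v u" unfolding noise_coeffs_def using le_add2 by blast
  then show ?thesis by (rule that)
qed

section \<open>Vertex sets closed under parents\<close>

definition ancestral :: "(nat \<times> nat) set \<Rightarrow> nat set \<Rightarrow> bool" where
  "ancestral E \<Theta> \<longleftrightarrow> (\<forall>(a, b)\<in>E. b \<in> \<Theta> \<longrightarrow> a \<in> \<Theta>)"

lemma ancestralD: "ancestral E \<Theta> \<Longrightarrow> (a, b) \<in> E \<Longrightarrow> b \<in> \<Theta> \<Longrightarrow> a \<in> \<Theta>"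
  by (auto simp: ancestral_def)

text \<open>Row \<open>j\<close> of I - B applied to X gives the single noise variable of
  \<open>j\<close>; its quadratic form is therefore the noise variance.\<close>

lemma noise_coeffs_source:
  assumes "j < p"
  shows "noise_coeffs p B (\<lambda>k. (if k = j then 1 else 0) - B $$ (j, k)) (\<lambda>k. if k = j then 1 else 0)"
  using assms by (simp add: noise_coeffs_def if_distrib cong: if_cong)

text \<open>The argument runs against the edges: noise terms downstream of \<open>j\<close> cannot contribute, so
  \<open>\<epsilon>\<^sub>j\<close> has coefficient 1, and the last contributing vertex outside \<open>\<Theta>\<close> is a parent of \<open>j\<close>.\<close>

lemma noise_coeffs_missing_parent:
  assumes B: "B \<in> carrier_mat p p" and ac: "acyclic (edges B)"
    and anc: "ancestral (edges B) \<Theta>"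
    and j: "j < p" "j \<notin> \<Theta>" and par: "(k0, j) \<in> edges B" "k0 \<notin> \<Theta>"
    and v: "v j = 1" "\<And>i. i \<notin> insert j \<Theta> \<Longrightarrow> v i = 0"
    and u: "noise_coeffs p B v u"
  shows "u j = 1" and "\<exists>k. (k, j) \<in> edges B \<and> u k = B $$ (j, k)"
proof -
  obtain r :: "nat \<Rightarrow> nat" where r: "\<And>k j. (k, j) \<in> edges B \<Longrightarrow> r k < r j"
    using acyclic_finite_rank[OF ac finite_edges] by blast
  have u_eq: "u k = v k + (\<Sum>c<p. B $$ (c, k) * u c)" if "k < p" for k
    using u that unfolding noise_coeffs_def by blast
  define R where "R = Suc (\<Sum>k<p. r k)"
  have R: "r k < R" if "k < p" for k
    using member_le_sum[of k "{..<p}" r] that by (auto simp: R_def)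
  \<comment> \<open>Outside \<Theta>, from the rank of \<open>j\<close> upwards and away from
    \<open>j\<close>, \<open>v\<close> is 0 and every child is again such a vertex: it has larger
    rank, and it is outside \<Theta> since \<Theta> is closed under parents. Induction starts at the
    largest ranks.\<close>
  have desc: "u t = 0" if "t < p" "t \<notin> \<Theta>" "t \<noteq> j" "r j \<le> r t" for t
    using that
  proof (induction "R - r t" arbitrary: t rule: less_induct)
    case less
    have "B $$ (c, t) * u c = 0" if "c < p" for c
    proof (cases "B $$ (c, t) = 0")
      case False
      then have e: "(t, c) \<in> edges B" using that less.prems by (simp add: edges_iff[OF B])
      then have "r t < r c" by (rule r)
      moreover have "c \<notin> \<Theta>" using ancestralD[OF anc e] less.prems by blast
      moreover have "R - r c < R - r t" using \<open>r t < r c\<close> R[OF that] by linarith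
      ultimately have "u c = 0" using less.prems that by (intro less.hyps) auto
      then show ?thesis by simp
    qed simp
    then have "(\<Sum>c<p. B $$ (c, t) * u c) = 0" by (intro sum.neutral) blast
    then show "u t = 0"
      using u_eq[OF less.prems(1)] v(2)[of t] less.prems by simp
  qed
  have zero_j: "B $$ (c, j) * u c = 0" if "c < p" for c
  proof (cases "B $$ (c, j) = 0")
    case False
    then have e: "(j, c) \<in> edges B" using that j by (simp add: edges_iff[OF B])
    then have "r j < r c" by (rule r)
    moreover have "c \<notin> \<Theta>" using ancestralD[OF anc e] j by blast
    ultimately have "u c = 0" using that by (intro desc) auto
    then show ?thesis by simp
  qed simp
  then have "(\<Sum>c<p. B $$ (c, j) * u c) = 0" by (intro sum.neutral) blast
  then show uj: "u j = 1"
    using u_eq[OF j(1)] v(1) by simp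
  let ?K = "{k. k < p \<and> k \<notin> \<Theta> \<and> k \<noteq> j \<and> u k \<noteq> 0}"
  have k0: "k0 < p" "k0 \<noteq> j" "B $$ (j, k0) \<noteq> 0"
    using par r[OF par(1)] by (auto simp: edges_iff[OF B])
  \<comment> \<open>If all later vertices outside \<Theta> except \<open>j\<close> have coefficient
    0, then \<open>j\<close> is the only child of \<open>k\<close> that can contribute.\<close>
  have step: "u k = B $$ (j, k) * u j"
    if k: "k < p" "k \<notin> \<Theta>" "k \<noteq> j" and z: "\<And>c. c < p \<Longrightarrow> c \<notin> \<Theta> \<Longrightarrow> c \<noteq> j \<Longrightarrow> r k < r c \<Longrightarrow> u c = 0" for k
  proof -
    have "B $$ (c, k) * u c = 0" if "c \<in> {..<p} - {j}" for c
    proof (cases "B $$ (c, k) = 0")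
      case False
      then have e: "(k, c) \<in> edges B" using that k by (simp add: edges_iff[OF B])
      have "c \<notin> \<Theta>" using ancestralD[OF anc e] k by blast
      then have "u c = 0" using r[OF e] that by (intro z) auto
      then show ?thesis by simp
    qed simp
    then have "(\<Sum>c<p. B $$ (c, k) * u c) = (\<Sum>c\<in>{j}. B $$ (c, k) * u c)"
      using j by (intro sum.mono_neutral_right ballI) (assumption | simp)+
    then show ?thesis using u_eq[OF k(1)] v(2)[of k] k by simp
  qed
  \<comment> \<open>If no vertex outside \<Theta> other than \<open>j\<close> contributed,
    \<open>step\<close> would apply to the missing parent \<open>k0\<close> and give it the nonzero
    coefficient \<open>B $$ (j, k0)\<close>. The vertex of largest rank in \<open>?K\<close> then
    satisfies the hypothesis of \<open>step\<close>.\<close>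
  obtain k1 where k1: "k1 \<in> ?K"
  proof (rule ccontr)
    assume "\<not> thesis"
    then have K: "?K = {}" using that by blast
    then have "u k0 = B $$ (j, k0) * u j"
      using k0 par by (intro step) blast+
    then have "k0 \<in> ?K" using k0 par uj by simp
    with K show False by blast
  qed
  define k where "k = arg_max r (\<lambda>k. k \<in> ?K)"
  have "k \<in> ?K \<and> (\<forall>c. c \<in> ?K \<longrightarrow> r c \<le> r k)"
    unfolding k_def using k1 by (rule arg_max_nat_lemma[where b = R]) (simp add: R)
  then have k: "k \<in> ?K" "\<And>c. c \<in> ?K \<Longrightarrow> r c \<le> r k"
    by simp_all
  have "u k = B $$ (j, k) * u j"
    using k by (intro step) (auto simp: not_le[symmetric])
  with k uj j show "\<exists>k. (k, j) \<in> edges B \<and> u k = B $$ (j, k)"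
    by (intro exI[of _ k]) (auto simp: edges_iff[OF B])
qed

subsection \<open>The algorithm under a small perturbation\<close>

text \<open>Each |v a * v b| is at most the mean of the two squares, and summing over all pairs
  counts every square \<open>p\<close> times.\<close>

lemma quad_form_perturb:
  assumes close: "\<And>a b. a < p \<Longrightarrow> b < p \<Longrightarrow> \<bar>A $$ (a, b) - C $$ (a, b)\<bar> \<le> \<delta>"
  shows "\<bar>quad_form p A v - quad_form p C v\<bar> \<le> real p * \<delta> * (\<Sum>i<p. (v i)\<^sup>2)"
proof -
  have "quad_form p A v - quad_form p C v = (\<Sum>a<p. \<Sum>b<p. (A $$ (a, b) - C $$ (a, b)) * v a * v b)"
    by (simp add: quad_form_altdef sum_subtractf[symmetric] algebra_simps)
  also have "\<bar>\<dots>\<bar> \<le> (\<Sum>a<p. \<Sum>b<p. \<bar>(A $$ (a, b) - C $$ (a, b)) * v a * v b\<bar>)"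
    by (rule order_trans[OF sum_abs sum_mono[OF sum_abs]])
  also have "\<dots> \<le> (\<Sum>a<p. \<Sum>b<p. \<delta> * (((v a)\<^sup>2 + (v b)\<^sup>2) / 2))"
  proof (intro sum_mono)
    fix a b assume "a \<in> {..<p}" "b \<in> {..<p}"
    then have "\<bar>A $$ (a, b) - C $$ (a, b)\<bar> \<le> \<delta>" by (intro close) auto
    moreover have "\<bar>v a * v b\<bar> \<le> ((v a)\<^sup>2 + (v b)\<^sup>2) / 2"
      using sum_squares_bound[of "\<bar>v a\<bar>" "\<bar>v b\<bar>"] by (simp add: abs_mult)
    ultimately have "\<bar>A $$ (a, b) - C $$ (a, b)\<bar> * \<bar>v a * v b\<bar> \<le> \<delta> * (((v a)\<^sup>2 + (v b)\<^sup>2) / 2)"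
      by (intro mult_mono) auto
    then show "\<bar>(A $$ (a, b) - C $$ (a, b)) * v a * v b\<bar> \<le> \<delta> * (((v a)\<^sup>2 + (v b)\<^sup>2) / 2)"
      by (simp add: abs_mult mult.assoc)
  qed
  also have "\<dots> = \<delta> * ((\<Sum>a<p. \<Sum>b<p. (v a)\<^sup>2) + (\<Sum>a<p. \<Sum>b<p. (v b)\<^sup>2)) / 2"
    by (simp only: sum_distrib_left[symmetric] sum_divide_distrib[symmetric] sum.distrib times_divide_eq_right)
  also have "\<dots> = real p * \<delta> * (\<Sum>i<p. (v i)\<^sup>2)"
    by (simp add: sum_distrib_left[symmetric] algebra_simps)
  finally show ?thesis .
qed

lemma noise_variance_unit:
  fixes j p :: nat
  assumes "j < p"
  shows "(\<Sum>k<p. (if k = j then 1 else 0 :: real)\<^sup>2) = 1"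
proof -
  have "(\<Sum>k<p. (if k = j then 1 else 0 :: real)\<^sup>2) = (\<Sum>k<p. if k = j then 1 else 0)"
    by (intro sum.cong) auto
  also have "\<dots> = 1" using assms by (subst sum.delta) auto
  finally show ?thesis .
qed

text \<open>Reduces correctness to a single greedy step. Prefixes stay closed under parents because
  every chosen vertex has its parents chosen before; applying \<open>step\<close> at the time
  \<open>j\<close> is chosen puts the source of an edge into \<open>j\<close> in front of
  it.\<close>

lemma topological_orderingI:
  assumes out: "topo_alg_output p f A \<theta>" and E: "E \<subseteq> {..<p} \<times> {..<p}"
    and step: "\<And>\<Theta> j k. \<Theta> \<subseteq> {..<p} \<Longrightarrow> ancestral E \<Theta> \<Longrightarrow>
      is_arg_min (f A \<Theta>) (\<lambda>j. j \<in> {..<p} - \<Theta>) j \<Longrightarrow> (k, j) \<in> E \<Longrightarrow> k \<in> \<Theta>"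
  shows "topological_ordering p E \<theta>"
proof -
  have len: "length \<theta> = p" using out by (simp add: topo_alg_output_def)
  have am: "is_arg_min (f A (set (take z \<theta>))) (\<lambda>j. j \<in> {..<p} - set (take z \<theta>)) (\<theta> ! z)" if "z < p" for z
    using out that by (simp add: topo_alg_output_def)
  have new: "\<theta> ! z < p" "\<theta> ! z \<notin> set (take z \<theta>)" if "z < p" for z
    using am[OF that] by (auto simp: is_arg_min_def)
  have sub: "set (take z \<theta>) \<subseteq> {..<p}" for z
    using new(1) len by (auto simp: in_set_conv_nth)
  have anc: "ancestral E (set (take z \<theta>))" if "z \<le> p" for z
    using that
  proof (induction z)
    case (Suc z)
    then have IH: "ancestral E (set (take z \<theta>))" and z: "z < p" by auto
    have tk: "set (take (Suc z) \<theta>) = insert (\<theta> ! z) (set (take z \<theta>))"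
      using z len by (simp add: take_Suc_conv_app_nth)
    have "a \<in> set (take z \<theta>)" if "(a, b) \<in> E" "b \<in> insert (\<theta> ! z) (set (take z \<theta>))" for a b
    proof (cases "b = \<theta> ! z")
      case True
      with that(1) show ?thesis by (intro step[OF sub IH am[OF z]]) simp
    next
      case False
      with that show ?thesis by (intro ancestralD[OF IH that(1)]) simp
    qed
    then show ?case by (auto simp: tk ancestral_def)
  qed (simp add: ancestral_def)
  have dist: "distinct \<theta>"
    unfolding distinct_conv_nth
  proof (intro allI impI)
    have *: "\<theta> ! a \<noteq> \<theta> ! b" if "a < b" "b < p" for a b
      using new(2)[OF that(2)] that len by (auto simp: in_set_conv_nth)
    show "\<theta> ! a \<noteq> \<theta> ! b" if "a < length \<theta>" "b < length \<theta>" "a \<noteq> b" for a b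
      using *[of a b] *[of b a] that len by (metis nat_neq_iff)
  qed
  have "set \<theta> = {..<p}"
    using sub[of p] dist len by (intro card_subset_eq) (auto simp: distinct_card)
  moreover have "\<exists>a b. a < b \<and> b < length \<theta> \<and> \<theta> ! a = k \<and> \<theta> ! b = j" if kj: "(k, j) \<in> E" for k j
  proof -
    have "j \<in> set \<theta>" using kj E \<open>set \<theta> = {..<p}\<close> by auto
    then obtain b where b: "b < length \<theta>" "\<theta> ! b = j" by (auto simp: in_set_conv_nth)
    have "k \<in> set (take b \<theta>)"
      by (rule step[OF sub anc am[of b]]) (use b len kj in auto)
    then obtain a where "a < b" "\<theta> ! a = k" by (auto simp: in_set_conv_nth)
    with b show ?thesis by blast
  qed
  ultimately show ?thesis
    using dist by (auto simp: topological_ordering_def)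
qed

text \<open>\<open>C\<close> is the covariance matrix of the model and \<open>l\<close> a lower bound of its spectrum.\<close>

locale sem_cov =
  fixes p :: nat and B C :: "real mat" and \<sigma> \<zeta> l :: real
  assumes p: "1 \<le> p"
    and B: "B \<in> carrier_mat p p" and diag: "j < p \<Longrightarrow> B $$ (j, j) = 0"
    and ac: "acyclic (edges B)"
    and \<zeta>: "\<zeta> > 0" "(k, j) \<in> edges B \<Longrightarrow> \<zeta> \<le> (B $$ (j, k))\<^sup>2"
    and Cov: "noise_coeffs p B v u \<Longrightarrow> quad_form p C v = \<sigma>\<^sup>2 * (\<Sum>k<p. (u k)\<^sup>2)"
    and l: "l > 0" "l * (\<Sum>i<p. (v i)\<^sup>2) \<le> quad_form p C v"
begin

text \<open>Row 0 of I - B is a test vector: its form equals the noise variance, while its norm is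
  at least 1 because the diagonal of \<open>B\<close> is zero.\<close>

lemma l_le_noise_variance: "l \<le> \<sigma>\<^sup>2"
proof -
  let ?v = "\<lambda>k. (if k = 0 then 1 else 0) - B $$ (0, k)"
  have "0 < p" using p by simp
  have "(?v 0)\<^sup>2 \<le> (\<Sum>i<p. (?v i)\<^sup>2)"
    using \<open>0 < p\<close> by (intro member_le_sum) auto
  then have "l \<le> l * (\<Sum>i<p. (?v i)\<^sup>2)"
    using l diag[OF \<open>0 < p\<close>] by simp
  also have "\<dots> \<le> quad_form p C ?v" by (rule l)
  also have "\<dots> = \<sigma>\<^sup>2"
    using Cov[OF noise_coeffs_source[OF \<open>0 < p\<close>]] noise_variance_unit[OF \<open>0 < p\<close>] by simp
  finally show ?thesis .
qed

text \<open>The hypothesis on \<open>\<eta>\<close> is exactly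
  \<open>\<sigma>\<^sup>2 (1 + \<eta> / l) < (\<sigma>\<^sup>2 + \<zeta> l) (1 - \<eta> / l)\<close>, which separates the two values of the criterion.\<close>

lemma argmin_f1_parents:
  assumes A: "A \<in> carrier_mat p p" and sym: "sym_on p A"
    and close: "\<And>v. \<bar>quad_form p A v - quad_form p C v\<bar> \<le> \<eta> * (\<Sum>i<p. (v i)\<^sup>2)"
    and \<eta>: "0 \<le> \<eta>" "\<eta> * (\<zeta> * l + 2 * \<sigma>\<^sup>2) < \<zeta> * l\<^sup>2"
    and \<Theta>: "\<Theta> \<subseteq> {..<p}" and anc: "ancestral (edges B) \<Theta>"
    and min: "is_arg_min (f1 u A \<Theta>) (\<lambda>j. j \<in> {..<p} - \<Theta>) j"
    and e: "(k, j) \<in> edges B"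
  shows "k \<in> \<Theta>"
proof (rule ccontr)
  assume "k \<notin> \<Theta>"
  have j: "j < p" "j \<notin> \<Theta>" using min by (auto simp: is_arg_min_def)
  \<comment> \<open>Dropping the noise term from the hypothesis leaves \<eta> < l, so
    \<open>A\<close> inherits positive definiteness from \<open>C\<close>.\<close>
  have "\<eta> * (\<zeta> * l) \<le> \<eta> * (\<zeta> * l + 2 * \<sigma>\<^sup>2)" using \<eta>(1) by (intro mult_left_mono) auto
  with \<eta>(2) have "\<eta> * (\<zeta> * l) < l * (\<zeta> * l)" by (simp add: power2_eq_square mult_ac)
  then have "\<eta> < l" using \<zeta>(1) l(1) by simp
  have pd: "pos_def_on p A"
    unfolding pos_def_on_def
  proof (intro allI impI)
    fix v :: "nat \<Rightarrow> real" assume "\<exists>i<p. v i \<noteq> 0"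
    then have "0 < (\<Sum>i<p. (v i)\<^sup>2)"
      by (auto intro!: sum_pos2)
    then have "0 < (l - \<eta>) * (\<Sum>i<p. (v i)\<^sup>2)" using \<open>\<eta> < l\<close> by simp
    then show "0 < quad_form p A v"
      using close[of v] l(2)[of v] by (simp add: algebra_simps)
  qed
  \<comment> \<open>The spectral bound turns the absolute error \<eta> |v|^2 into a relative error
    \<eta> / l.\<close>
  have close_rel: "\<eta> * (\<Sum>i<p. (v i)\<^sup>2) \<le> \<eta> / l * quad_form p C v" for v
    using mult_left_mono[OF l(2)[of v], of "\<eta> / l"] l(1) \<eta>(1) by simp

  obtain r :: "nat \<Rightarrow> nat" where r: "\<And>k j. (k, j) \<in> edges B \<Longrightarrow> r k < r j"
    using acyclic_finite_rank[OF ac finite_edges] by blast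
  \<comment> \<open>A vertex of least rank outside \<Theta> has all its parents in \<Theta>. It is
    the competitor that beats \<open>j\<close>, with row \<open>s\<close> of I - B as test vector
    for the upper bound.\<close>
  define s where "s = arg_min r (\<lambda>i. i \<in> {..<p} - \<Theta>)"
  have "s \<in> {..<p} - \<Theta> \<and> (\<forall>y. y \<in> {..<p} - \<Theta> \<longrightarrow> r s \<le> r y)"
    unfolding s_def by (rule arg_min_nat_lemma[where k = j]) (use j in simp)
  then have s: "s < p" "s \<notin> \<Theta>" and s_min: "\<And>y. y < p \<Longrightarrow> y \<notin> \<Theta> \<Longrightarrow> r s \<le> r y" by auto
  have s_par: "B $$ (s, i) = 0" if "i < p" "i \<notin> \<Theta>" for i
    using s_min[OF that] r[of i s] that s by (force simp: edges_iff[OF B])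
  let ?w = "\<lambda>k. (if k = s then 1 else 0) - B $$ (s, k)"
  have Cw: "quad_form p C ?w = \<sigma>\<^sup>2"
    using Cov[OF noise_coeffs_source[OF s(1)]] noise_variance_unit[OF s(1)] by simp
  have "f1 u A \<Theta> s \<le> quad_form p A ?w"
    using diag[OF s(1)] by (intro f1_le_quad_form[OF A sym pd \<Theta> s]) (auto simp: s_par)
  also have "\<dots> \<le> \<sigma>\<^sup>2 + \<eta> / l * \<sigma>\<^sup>2"
    using close[of ?w] close_rel[of ?w] unfolding Cw by linarith
  finally have up: "f1 u A \<Theta> s \<le> \<sigma>\<^sup>2 + \<eta> / l * \<sigma>\<^sup>2" .

  obtain v where v: "v j = 1" "\<And>i. i \<notin> insert j \<Theta> \<Longrightarrow> v i = 0" "f1 u A \<Theta> j = quad_form p A v"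
    by (rule f1_eq_quad_form[OF A pd \<Theta> j, of u]) blast
  obtain x where x: "noise_coeffs p B v x"
    using noise_coeffs_exist[OF B ac] by blast
  have xj: "x j = 1"
    using noise_coeffs_missing_parent(1)[OF B ac anc j e \<open>k \<notin> \<Theta>\<close> v(1,2) x] .
  obtain k' where k': "(k', j) \<in> edges B" "x k' = B $$ (j, k')"
    using noise_coeffs_missing_parent(2)[OF B ac anc j e \<open>k \<notin> \<Theta>\<close> v(1,2) x] by blast
  have k'j: "k' \<noteq> j" "k' < p" using k' r[OF k'(1)] by (auto simp: edges_iff[OF B])
  \<comment> \<open>Two distinct noise variables contribute: \<open>j\<close> itself with
    coefficient 1, and a parent \<open>k'\<close> with squared coefficient at least \<zeta>.\<close>
  have "1 + \<zeta> \<le> (x j)\<^sup>2 + (x k')\<^sup>2" using \<zeta>(2)[OF k'(1)] k'(2) xj by simp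
  also have "\<dots> = (\<Sum>i\<in>{j, k'}. (x i)\<^sup>2)" using k'j by simp
  also have "\<dots> \<le> (\<Sum>i<p. (x i)\<^sup>2)" using k'j j by (intro sum_mono2) auto
  finally have "\<sigma>\<^sup>2 * (1 + \<zeta>) \<le> quad_form p C v"
    unfolding Cov[OF x] by (rule mult_left_mono) simp
  moreover have "\<zeta> * l \<le> \<zeta> * \<sigma>\<^sup>2" using l_le_noise_variance \<zeta>(1) by simp
  ultimately have low: "\<sigma>\<^sup>2 + \<zeta> * l \<le> quad_form p C v" by (simp add: algebra_simps)
  have "\<sigma>\<^sup>2 * (l + \<eta>) < (\<sigma>\<^sup>2 + \<zeta> * l) * (l - \<eta>)"
    using \<eta>(2) by (simp add: algebra_simps power2_eq_square)
  then have "\<sigma>\<^sup>2 * (l + \<eta>) / l < (\<sigma>\<^sup>2 + \<zeta> * l) * (l - \<eta>) / l"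
    using l(1) by (rule divide_strict_right_mono)
  also have "\<sigma>\<^sup>2 * (l + \<eta>) / l = \<sigma>\<^sup>2 + \<eta> / l * \<sigma>\<^sup>2"
    using l(1) by (simp add: field_simps)
  also have "(\<sigma>\<^sup>2 + \<zeta> * l) * (l - \<eta>) / l = (\<sigma>\<^sup>2 + \<zeta> * l) * (1 - \<eta> / l)"
    using l(1) by (simp add: field_simps)
  also have "\<dots> \<le> quad_form p C v * (1 - \<eta> / l)"
    using low \<open>\<eta> < l\<close> l(1) by (intro mult_right_mono) auto
  also have "\<dots> = quad_form p C v - \<eta> / l * quad_form p C v"
    by (simp add: algebra_simps)
  also have "\<dots> \<le> quad_form p A v"
    using close[of v] close_rel[of v] by linarith
  finally have "f1 u A \<Theta> s < f1 u A \<Theta> j"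
    using up v(3) by linarith
  with min s show False by (auto simp: is_arg_min_def)
qed

lemma topo_alg_correct:
  assumes A: "A \<in> carrier_mat p p" and sym: "sym_on p A"
    and close: "\<And>a b. a < p \<Longrightarrow> b < p \<Longrightarrow> \<bar>A $$ (a, b) - C $$ (a, b)\<bar> < \<delta>"
    and \<delta>: "real p * \<delta> * (\<zeta> * l + 2 * \<sigma>\<^sup>2) \<le> \<zeta> * l\<^sup>2"
    and out: "topo_alg_output p (f1 u) A \<theta>"
  shows "topological_ordering p (edges B) \<theta>"
proof (rule topological_orderingI[OF out])
  show "edges B \<subseteq> {..<p} \<times> {..<p}" using B by (auto simp: edges_def)
  let ?D = "(\<lambda>(a, b). \<bar>A $$ (a, b) - C $$ (a, b)\<bar>) ` ({..<p} \<times> {..<p})"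
  \<comment> \<open>The maximum of finitely many deviations is still strictly below \<delta>. This
    gives the strict inequality for \<eta> although the condition on \<delta> allows
    equality.\<close>
  define \<delta>' where "\<delta>' = Max ?D"
  have "(\<lambda>(a, b). \<bar>A $$ (a, b) - C $$ (a, b)\<bar>) (0, 0) \<in> ?D" using p by (intro imageI) auto
  then have "?D \<noteq> {}" by blast
  then have "\<delta>' \<in> ?D" unfolding \<delta>'_def by (intro Max_in) auto
  then have \<delta>': "0 \<le> \<delta>'" "\<delta>' < \<delta>" using close by auto
  have close': "\<bar>A $$ (a, b) - C $$ (a, b)\<bar> \<le> \<delta>'" if "a < p" "b < p" for a b
    unfolding \<delta>'_def using that by (intro Max_ge) auto
  define \<eta> where "\<eta> = real p * \<delta>'"
  have "0 < \<zeta> * l + 2 * \<sigma>\<^sup>2" using \<zeta>(1) l(1) by (intro add_pos_nonneg) auto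
  then have "\<eta> * (\<zeta> * l + 2 * \<sigma>\<^sup>2) < real p * \<delta> * (\<zeta> * l + 2 * \<sigma>\<^sup>2)"
    unfolding \<eta>_def using \<delta>' p by (intro mult_strict_right_mono mult_strict_left_mono) auto
  with \<delta> have \<eta>: "\<eta> * (\<zeta> * l + 2 * \<sigma>\<^sup>2) < \<zeta> * l\<^sup>2" by linarith
  have \<eta>0: "0 \<le> \<eta>" using \<delta>' by (simp add: \<eta>_def)
  have cl: "\<bar>quad_form p A v - quad_form p C v\<bar> \<le> \<eta> * (\<Sum>i<p. (v i)\<^sup>2)" for v
    unfolding \<eta>_def by (rule quad_form_perturb[OF close'])
  fix \<Theta> j k
  assume \<Theta>: "\<Theta> \<subseteq> {..<p}" and anc: "ancestral (edges B) \<Theta>"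
    and min: "is_arg_min (f1 u A \<Theta>) (\<lambda>j. j \<in> {..<p} - \<Theta>) j" and e: "(k, j) \<in> edges B"
  show "k \<in> \<Theta>"
    by (rule argmin_f1_parents[OF A sym cl \<eta>0 \<eta> \<Theta> anc min e])
qed

end

subsection \<open>Products of sub-Gaussian variables\<close>

lemma nn_integral_normal_density:
  assumes "0 < s"
  shows "(\<integral>\<^sup>+x. ennreal (normal_density m s x) \<partial>lborel) = 1"
  using assms by (subst nn_integral_eq_integral) auto

text \<open>Completing the square turns the tilted density into the normal density with mean
  \<open>a\<close>, up to a constant factor.\<close>

lemma nn_integral_std_normal_exp_linear:
  "(\<integral>\<^sup>+x. ennreal (std_normal_density x * exp (a * x)) \<partial>lborel) = ennreal (exp (a\<^sup>2 / 2))"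
proof -
  have "std_normal_density x * exp (a * x) = exp (a\<^sup>2 / 2) * normal_density a 1 x" for x
    by (simp add: normal_density_def exp_add[symmetric] power2_eq_square field_simps)
  then show ?thesis
    by (simp add: ennreal_mult nn_integral_cmult nn_integral_normal_density)
qed

text \<open>The exponent - 1/2 + 3/8 = - 1/8 belongs to standard deviation 2, whose normalising
  constant is smaller by the factor 2.\<close>

lemma nn_integral_std_normal_exp_square:
  "(\<integral>\<^sup>+x. ennreal (std_normal_density x * exp (3 / 8 * x\<^sup>2)) \<partial>lborel) = 2"
proof -
  have "sqrt (8 :: real) = sqrt (4 * 2)" by simp
  also have "\<dots> = 2 * sqrt 2" by (simp only: real_sqrt_mult real_sqrt_four)
  finally have "std_normal_density x * exp (3 / 8 * x\<^sup>2) = 2 * normal_density 0 2 x" for x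
    by (simp add: normal_density_def exp_add[symmetric] real_sqrt_mult field_simps)
  then show ?thesis
    by (simp add: ennreal_mult nn_integral_cmult nn_integral_normal_density)
qed

text \<open>\<open>exp (3/8 y\<^sup>2)\<close> is a Gaussian average of exponentials \<open>exp (t y)\<close>, so by Fubini the bound on the
  moment generating function can be integrated against the Gaussian density.\<close>

lemma (in prob_space) sub_gaussian_exp_square:
  assumes [measurable]: "Y \<in> borel_measurable M" and Y: "sub_gaussian M \<tau> Y" and "\<tau> > 0"
  shows "(\<integral>\<^sup>+\<omega>. ennreal (exp (3 / 8 * (Y \<omega>)\<^sup>2 / \<tau>\<^sup>2)) \<partial>M) \<le> 2"
proof -
  interpret pair_sigma_finite M lborel ..
  \<comment> \<open>With this scale the Gaussian average reproduces the exponent 3/8 Y^2 / \<tau>^2,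
    while the moment bound becomes 3/8 x^2, below the critical 1/2.\<close>
  define c where "c = sqrt (3 / 4) / \<tau>"
  have c2: "c\<^sup>2 = 3 / (4 * \<tau>\<^sup>2)" by (simp add: c_def power_divide)
  have "ennreal (exp (3 / 8 * (Y \<omega>)\<^sup>2 / \<tau>\<^sup>2)) =
      (\<integral>\<^sup>+x. ennreal (std_normal_density x * exp (c * Y \<omega> * x)) \<partial>lborel)" for \<omega>
    unfolding nn_integral_std_normal_exp_linear by (simp add: power_mult_distrib c2)
  then have "(\<integral>\<^sup>+\<omega>. ennreal (exp (3 / 8 * (Y \<omega>)\<^sup>2 / \<tau>\<^sup>2)) \<partial>M) =
      (\<integral>\<^sup>+\<omega>. (\<integral>\<^sup>+x. ennreal (std_normal_density x * exp (c * Y \<omega> * x)) \<partial>lborel) \<partial>M)"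
    by simp
  also have "\<dots> = (\<integral>\<^sup>+x. (\<integral>\<^sup>+\<omega>. ennreal (std_normal_density x * exp (c * Y \<omega> * x)) \<partial>M) \<partial>lborel)"
    by (rule Fubini'[symmetric]) measurable
  also have "\<dots> \<le> (\<integral>\<^sup>+x. ennreal (std_normal_density x * exp (3 / 8 * x\<^sup>2)) \<partial>lborel)"
  proof (rule nn_integral_mono)
    fix x
    have "(\<integral>\<^sup>+\<omega>. ennreal (std_normal_density x * exp (c * Y \<omega> * x)) \<partial>M) =
        ennreal (std_normal_density x) * (\<integral>\<^sup>+\<omega>. ennreal (exp ((c * x) * Y \<omega>)) \<partial>M)"
      by (simp add: ennreal_mult nn_integral_cmult mult_ac)
    also have "(\<integral>\<^sup>+\<omega>. ennreal (exp ((c * x) * Y \<omega>)) \<partial>M) = ennreal (\<integral>\<omega>. exp ((c * x) * Y \<omega>) \<partial>M)"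
      using Y by (intro nn_integral_eq_integral) (auto simp: sub_gaussian_def)
    also have "\<dots> \<le> ennreal (exp (\<tau>\<^sup>2 * (c * x)\<^sup>2 / 2))"
      using Y by (intro ennreal_leI) (auto simp: sub_gaussian_def)
    also have "\<tau>\<^sup>2 * (c * x)\<^sup>2 / 2 = 3 / 8 * x\<^sup>2"
      using \<open>\<tau> > 0\<close> by (simp add: power_mult_distrib c2)
    finally show "(\<integral>\<^sup>+\<omega>. ennreal (std_normal_density x * exp (c * Y \<omega> * x)) \<partial>M) \<le>
        ennreal (std_normal_density x * exp (3 / 8 * x\<^sup>2))"
      by (simp add: ennreal_mult mult_left_mono)
  qed
  finally show ?thesis unfolding nn_integral_std_normal_exp_square .
qed

text \<open>Taylor expansion with Lagrange remainder. The linear term is kept exact so that it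
  integrates to 0 for a centred variable.\<close>

lemma exp_le_quadratic: "exp x \<le> 1 + x + x\<^sup>2 / 2 * exp \<bar>x\<bar>" for x :: real
proof (cases "x = 0")
  case False
  obtain t where t: "\<bar>t\<bar> \<le> \<bar>x\<bar>" "exp x = (\<Sum>m<2. x ^ m / fact m) + exp t / fact 2 * x ^ 2"
    using Maclaurin_exp_le[of x 2] by auto
  have "exp t * x\<^sup>2 \<le> exp \<bar>x\<bar> * x\<^sup>2" using t(1) by (intro mult_right_mono) auto
  then show ?thesis using t(2) by (simp add: numeral_2_eq_2 field_simps)
qed simp

lemma square_le_exp: "x\<^sup>2 \<le> 2 * exp x" if "0 \<le> x" for x :: real
  using exp_lower_Taylor_quadratic[OF that] that by linarith

text \<open>In the second-order expansion the linear term has mean 0. The remainder is at most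
  \<open>s\<^sup>2 * \<kappa>\<^sup>2\<close> times three copies of an integrable \<open>g\<close>
  with mean at most 4, whence the constant 12. The bounds on \<open>s\<close> and
  \<open>\<tau>\<close> keep the exponential in the remainder below \<open>g\<close>.\<close>

lemma (in prob_space) product_mgf_le:
  assumes [measurable]: "Y \<in> borel_measurable M" "Z \<in> borel_measurable M"
    and Y: "sub_gaussian M \<tau> Y" and Z: "sub_gaussian M \<tau> Z" and \<tau>: "\<tau> > 0"
    and \<kappa>: "4 * \<tau>\<^sup>2 \<le> \<kappa>" and int: "integrable M (\<lambda>\<omega>. Y \<omega> * Z \<omega>)"
    and \<mu>: "\<mu> = (\<integral>\<omega>. Y \<omega> * Z \<omega> \<partial>M)" "\<bar>\<mu>\<bar> \<le> \<kappa>" and s: "\<bar>s\<bar> * \<kappa> \<le> 1 / 2"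
  shows "integrable M (\<lambda>\<omega>. exp (s * (Y \<omega> * Z \<omega> - \<mu>)))" (is ?int)
    and "(\<integral>\<omega>. exp (s * (Y \<omega> * Z \<omega> - \<mu>)) \<partial>M) \<le> exp (12 * s\<^sup>2 * \<kappa>\<^sup>2)" (is ?le)
proof -
  have "0 < \<tau>\<^sup>2" using \<tau> by simp
  then have \<kappa>0: "0 < \<kappa>" using \<kappa> by linarith
  define g where "g \<omega> = exp (3 / 8 * (Y \<omega>)\<^sup>2 / \<tau>\<^sup>2) + exp (3 / 8 * (Z \<omega>)\<^sup>2 / \<tau>\<^sup>2)" for \<omega>
  have [measurable]: "g \<in> borel_measurable M" unfolding g_def by measurable
  have g_nn: "(\<integral>\<^sup>+\<omega>. ennreal (g \<omega>) \<partial>M) \<le> 4"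
  proof -
    have "(\<integral>\<^sup>+\<omega>. ennreal (g \<omega>) \<partial>M) =
        (\<integral>\<^sup>+\<omega>. ennreal (exp (3 / 8 * (Y \<omega>)\<^sup>2 / \<tau>\<^sup>2)) \<partial>M) + (\<integral>\<^sup>+\<omega>. ennreal (exp (3 / 8 * (Z \<omega>)\<^sup>2 / \<tau>\<^sup>2)) \<partial>M)"
      unfolding g_def by (subst ennreal_plus) (auto intro!: nn_integral_add)
    also have "\<dots> \<le> 2 + 2"
      by (intro add_mono sub_gaussian_exp_square Y Z \<tau>) measurable
    finally show ?thesis by simp
  qed
  have g_pos: "0 \<le> g \<omega>" for \<omega> by (simp add: g_def)
  have g_int: "integrable M g"
    using g_nn by (intro integrableI_nonneg) (auto simp: g_pos intro: le_less_trans)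
  have g_le: "(\<integral>\<omega>. g \<omega> \<partial>M) \<le> 4"
    using g_nn nn_integral_eq_integral[OF g_int] g_pos
    by (simp add: ennreal_le_iff[where y = 4, simplified])
  define W where "W \<omega> = Y \<omega> * Z \<omega> - \<mu>" for \<omega>
  have [measurable]: "W \<in> borel_measurable M" unfolding W_def by measurable
  have W_int: "integrable M W" unfolding W_def using int by simp
  have W0: "(\<integral>\<omega>. W \<omega> \<partial>M) = 0" unfolding W_def using int \<mu> by (simp add: prob_space)
  have pt: "exp (s * W \<omega>) \<le> 1 + s * W \<omega> + s\<^sup>2 * \<kappa>\<^sup>2 * (3 * g \<omega>)" for \<omega>
  proof -
    \<comment> \<open>\<open>q\<close> measures |W| in units of \<kappa>; the summand 1 absorbs the
      mean \<mu>.\<close>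
    define q where "q = ((Y \<omega>)\<^sup>2 + (Z \<omega>)\<^sup>2) / (2 * \<kappa>) + 1"
    have q0: "0 \<le> q" unfolding q_def using \<kappa>0 by simp
    have "\<bar>Y \<omega> * Z \<omega>\<bar> \<le> ((Y \<omega>)\<^sup>2 + (Z \<omega>)\<^sup>2) / 2"
      using sum_squares_bound[of "\<bar>Y \<omega>\<bar>" "\<bar>Z \<omega>\<bar>"] by (simp add: abs_mult)
    then have "\<bar>W \<omega>\<bar> \<le> ((Y \<omega>)\<^sup>2 + (Z \<omega>)\<^sup>2) / 2 + \<kappa>" using \<mu>(2) unfolding W_def by linarith
    also have "\<dots> = \<kappa> * q" using \<kappa>0 by (simp add: q_def field_simps)
    finally have W: "\<bar>W \<omega>\<bar> \<le> \<kappa> * q" .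
    have "exp (s * W \<omega>) \<le> 1 + s * W \<omega> + (s * W \<omega>)\<^sup>2 / 2 * exp \<bar>s * W \<omega>\<bar>"
      by (rule exp_le_quadratic)
    also have "(s * W \<omega>)\<^sup>2 / 2 * exp \<bar>s * W \<omega>\<bar> \<le> (s\<^sup>2 * \<kappa>\<^sup>2 * q\<^sup>2) / 2 * exp (q / 2)"
    proof (intro mult_mono divide_right_mono)
      have "(W \<omega>)\<^sup>2 \<le> (\<kappa> * q)\<^sup>2" using W by (metis abs_ge_zero power2_abs power_mono)
      then show "(s * W \<omega>)\<^sup>2 \<le> s\<^sup>2 * \<kappa>\<^sup>2 * q\<^sup>2"
        by (simp add: power_mult_distrib mult_left_mono mult.assoc)
      have "\<bar>s * W \<omega>\<bar> \<le> \<bar>s\<bar> * (\<kappa> * q)" unfolding abs_mult using W by (intro mult_left_mono) auto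
      also have "\<dots> = (\<bar>s\<bar> * \<kappa>) * q" by simp
      also have "\<dots> \<le> 1 / 2 * q" using s q0 by (intro mult_right_mono)
      finally show "exp \<bar>s * W \<omega>\<bar> \<le> exp (q / 2)" by simp
    qed auto
    \<comment> \<open>The polynomial factor is traded for an exponential, so the exponents q and q /
      2 add up to 3/2 q.\<close>
    also have "(s\<^sup>2 * \<kappa>\<^sup>2 * q\<^sup>2) / 2 * exp (q / 2) \<le> (s\<^sup>2 * \<kappa>\<^sup>2 * (2 * exp q)) / 2 * exp (q / 2)"
      using square_le_exp[OF q0] by (intro mult_right_mono divide_right_mono mult_left_mono) auto
    also have "\<dots> = s\<^sup>2 * \<kappa>\<^sup>2 * exp (3 / 2 * q)"
      by (simp add: exp_add[symmetric])
    also have "exp (3 / 2 * q) \<le> 3 * g \<omega>"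
    proof -
      \<comment> \<open>Twice \<open>a\<close> and twice \<open>b\<close> are at most the exponents
        in \<open>g\<close>, because 4 \<tau>^2 \<le> \<kappa>; the product exp a * exp b is bounded
        by the mean of the squares.\<close>
      define a b where "a = 3 / 4 * ((Y \<omega>)\<^sup>2 / \<kappa>)" and "b = 3 / 4 * ((Z \<omega>)\<^sup>2 / \<kappa>)"
      have quad: "3 / 4 * (y\<^sup>2 / \<kappa>) \<le> 1 / 2 * (3 / 8 * y\<^sup>2 / \<tau>\<^sup>2)" for y
      proof -
        have "y\<^sup>2 / \<kappa> \<le> y\<^sup>2 / (4 * \<tau>\<^sup>2)"
          by (rule frac_le) (use \<kappa> \<open>0 < \<tau>\<^sup>2\<close> in auto)
        then show ?thesis by simp
      qed
      have "exp (3 / 2 * q) = exp (3 / 2) * (exp a * exp b)"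
        using \<kappa>0 by (simp add: exp_add[symmetric] q_def a_def b_def field_simps)
      also have "\<dots> \<le> 6 * (g \<omega> / 2)"
      proof (intro mult_mono)
        have "exp a * exp b \<le> ((exp a)\<^sup>2 + (exp b)\<^sup>2) / 2"
          using sum_squares_bound[of "exp a" "exp b"] by simp
        also have "\<dots> = (exp (2 * a) + exp (2 * b)) / 2"
          by (simp add: power2_eq_square exp_add[symmetric])
        also have "\<dots> \<le> (exp (3 / 8 * (Y \<omega>)\<^sup>2 / \<tau>\<^sup>2) + exp (3 / 8 * (Z \<omega>)\<^sup>2 / \<tau>\<^sup>2)) / 2"
          using quad[of "Y \<omega>"] quad[of "Z \<omega>"]
          by (intro divide_right_mono add_mono) (simp_all add: a_def b_def)
        finally show "exp a * exp b \<le> g \<omega> / 2" unfolding g_def .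
        have "exp (3 / 2 :: real) ^ 2 = exp 3" by (simp add: power2_eq_square exp_add[symmetric])
        also have "exp (3::real) = exp 1 ^ 3" by (simp add: exp_of_nat_mult[symmetric])
        also have "\<dots> \<le> 3 ^ 3"
          using exp_le by (intro power_mono) auto
        also have "\<dots> \<le> (6 :: real) ^ 2" by simp
        finally show "exp (3 / 2) \<le> (6 :: real)" by (rule power2_le_imp_le) simp
      qed auto
      finally show ?thesis by simp
    qed
    finally show ?thesis by (simp add: mult_left_mono)
  qed
  have R_int: "integrable M (\<lambda>\<omega>. 1 + s * W \<omega> + s\<^sup>2 * \<kappa>\<^sup>2 * (3 * g \<omega>))"
    using W_int g_int by simp
  have L_int: "integrable M (\<lambda>\<omega>. exp (s * W \<omega>))"
  proof (rule Bochner_Integration.integrable_bound[OF R_int])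
    show "AE \<omega> in M. norm (exp (s * W \<omega>)) \<le> norm (1 + s * W \<omega> + s\<^sup>2 * \<kappa>\<^sup>2 * (3 * g \<omega>))"
      using pt by (intro AE_I2) (smt (verit) exp_ge_zero real_norm_def)
  qed measurable
  then show ?int by (simp add: W_def)
  have "(\<integral>\<omega>. exp (s * W \<omega>) \<partial>M) \<le> (\<integral>\<omega>. 1 + s * W \<omega> + s\<^sup>2 * \<kappa>\<^sup>2 * (3 * g \<omega>) \<partial>M)"
    by (rule integral_mono[OF L_int R_int pt])
  also have "\<dots> = 1 + s\<^sup>2 * \<kappa>\<^sup>2 * (3 * (\<integral>\<omega>. g \<omega> \<partial>M))"
    using W_int g_int W0 by (simp add: prob_space)
  also have "\<dots> \<le> 1 + s\<^sup>2 * \<kappa>\<^sup>2 * (3 * 4)"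
    using g_le by (intro add_left_mono mult_left_mono) auto
  also have "\<dots> \<le> exp (12 * s\<^sup>2 * \<kappa>\<^sup>2)"
    using exp_ge_add_one_self[of "12 * s\<^sup>2 * \<kappa>\<^sup>2"] by (simp add: mult_ac)
  finally show ?le by (simp add: W_def)
qed

subsection \<open>Concentration of the sample covariance\<close>

text \<open>Chernoff's method; the sign \<open>c\<close> covers both tails at once.\<close>

lemma (in prob_space) sum_upper_tail:
  assumes indep: "indep_vars (\<lambda>_. borel) V {..<n}"
    and int: "\<And>i s. i < n \<Longrightarrow> \<bar>s\<bar> * \<kappa> \<le> 1 / 2 \<Longrightarrow> integrable M (\<lambda>\<omega>. exp (s * V i \<omega>))"
    and mgf: "\<And>i s. i < n \<Longrightarrow> \<bar>s\<bar> * \<kappa> \<le> 1 / 2 \<Longrightarrow> (\<integral>\<omega>. exp (s * V i \<omega>) \<partial>M) \<le> exp (12 * s\<^sup>2 * \<kappa>\<^sup>2)"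
    and t: "0 < t" "t \<le> \<kappa>" and sgn: "\<bar>c\<bar> = (1::real)"
  shows "prob {\<omega> \<in> space M. c * (\<Sum>i<n. V i \<omega>) \<ge> real n * t} \<le> exp (- (real n * t\<^sup>2 / (128 * \<kappa>\<^sup>2)))"
proof -
  have \<kappa>: "0 < \<kappa>" using t by linarith
  \<comment> \<open>This rate keeps |c r| \<kappa> at most 1/64, within the range of the moment
    bound, and gives the exponent factor 1/64 - 12/4096, which exceeds 1/128.\<close>
  define r where "r = t / (64 * \<kappa>\<^sup>2)"
  have r: "0 < r" using t \<kappa> by (simp add: r_def)
  have c2: "c\<^sup>2 = 1" using sgn by (metis one_power2 power2_abs)
  have "\<bar>c * r\<bar> = r" using r sgn by (simp add: abs_mult)
  then have "\<bar>c * r\<bar> * \<kappa> = t / (64 * \<kappa>)"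
    using \<kappa> by (simp add: r_def power2_eq_square)
  also have "\<dots> \<le> 1 / 2" using t \<kappa> by (simp add: field_simps)
  finally have s: "\<bar>c * r\<bar> * \<kappa> \<le> 1 / 2" .
  have ind: "indep_vars (\<lambda>_. borel) (\<lambda>i \<omega>. exp ((c * r) * V i \<omega>)) {..<n}"
    by (rule indep_vars_compose2[OF indep]) measurable
  let ?u = "\<lambda>\<omega>. \<Prod>i<n. exp ((c * r) * V i \<omega>)"
  have u_int: "integrable M ?u"
    by (rule indep_vars_integrable[OF _ ind]) (use int s in auto)
  have "(\<integral>\<omega>. ?u \<omega> \<partial>M) = (\<Prod>i<n. \<integral>\<omega>. exp ((c * r) * V i \<omega>) \<partial>M)"
    by (rule indep_vars_lebesgue_integral[OF _ ind]) (use int s in auto)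
  also have "\<dots> \<le> (\<Prod>i<n. exp (12 * (c * r)\<^sup>2 * \<kappa>\<^sup>2))"
    by (rule prod_mono) (use mgf s in auto)
  also have "\<dots> = exp (real n * (12 * r\<^sup>2 * \<kappa>\<^sup>2))"
    by (simp add: exp_of_nat_mult[symmetric] power_mult_distrib c2)
  finally have E: "(\<integral>\<omega>. ?u \<omega> \<partial>M) \<le> exp (real n * (12 * r\<^sup>2 * \<kappa>\<^sup>2))" .
  have u_eq: "?u \<omega> = exp (r * (c * (\<Sum>i<n. V i \<omega>)))" for \<omega>
    by (simp add: exp_sum[symmetric] sum_distrib_left mult_ac)
  have "{\<omega> \<in> space M. c * (\<Sum>i<n. V i \<omega>) \<ge> real n * t} = {\<omega> \<in> space M. ?u \<omega> \<ge> exp (r * (real n * t))}"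
    unfolding u_eq using r by auto
  also have "prob \<dots> \<le> (\<integral>\<omega>. ?u \<omega> \<partial>M) / exp (r * (real n * t))"
    by (rule integral_Markov_inequality_measure[OF u_int sets.empty_sets]) (auto simp: prod_nonneg)
  also have "\<dots> \<le> exp (real n * (12 * r\<^sup>2 * \<kappa>\<^sup>2)) / exp (r * (real n * t))"
    using E by (rule divide_right_mono) simp
  also have "\<dots> = exp (real n * (12 * r\<^sup>2 * \<kappa>\<^sup>2 - r * t))"
    by (simp add: exp_diff[symmetric] algebra_simps)
  also have "\<dots> \<le> exp (- (real n * t\<^sup>2 / (128 * \<kappa>\<^sup>2)))"
  proof -
    have "12 * r\<^sup>2 * \<kappa>\<^sup>2 - r * t = - (t\<^sup>2 / \<kappa>\<^sup>2) * (1 / 64 - 12 / 4096)"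
      using \<kappa> by (simp add: r_def power2_eq_square field_simps)
    also have "\<dots> \<le> - (t\<^sup>2 / \<kappa>\<^sup>2) * (1 / 128)"
      by (rule mult_left_mono_neg) auto
    finally have "real n * (12 * r\<^sup>2 * \<kappa>\<^sup>2 - r * t) \<le> real n * (- (t\<^sup>2 / \<kappa>\<^sup>2) * (1 / 128))"
      by (rule mult_left_mono) simp
    then show ?thesis by simp
  qed
  finally show ?thesis .
qed

lemma (in prob_space) sum_abs_tail:
  assumes indep: "indep_vars (\<lambda>_. borel) V {..<n}"
    and int: "\<And>i s. i < n \<Longrightarrow> \<bar>s\<bar> * \<kappa> \<le> 1 / 2 \<Longrightarrow> integrable M (\<lambda>\<omega>. exp (s * V i \<omega>))"
    and mgf: "\<And>i s. i < n \<Longrightarrow> \<bar>s\<bar> * \<kappa> \<le> 1 / 2 \<Longrightarrow> (\<integral>\<omega>. exp (s * V i \<omega>) \<partial>M) \<le> exp (12 * s\<^sup>2 * \<kappa>\<^sup>2)"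
    and t: "0 < t" "t \<le> \<kappa>"
  shows "prob {\<omega> \<in> space M. \<bar>\<Sum>i<n. V i \<omega>\<bar> \<ge> real n * t} \<le> 2 * exp (- (real n * t\<^sup>2 / (128 * \<kappa>\<^sup>2)))"
proof -
  let ?S = "\<lambda>c. {\<omega> \<in> space M. c * (\<Sum>i<n. V i \<omega>) \<ge> real n * t}"
  have V [measurable]: "V i \<in> borel_measurable M" if "i \<in> {..<n}" for i
    using indep that by (auto simp: indep_vars_def)
  have [measurable]: "?S c \<in> events" for c :: real by measurable
  have tail: "prob (?S c) \<le> exp (- (real n * t\<^sup>2 / (128 * \<kappa>\<^sup>2)))" if "\<bar>c\<bar> = 1" for c :: real
    by (rule sum_upper_tail[OF indep int mgf t that])
  have "prob {\<omega> \<in> space M. \<bar>\<Sum>i<n. V i \<omega>\<bar> \<ge> real n * t} \<le> prob (?S 1 \<union> ?S (- 1))"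
    by (rule finite_measure_mono) auto
  also have "\<dots> \<le> prob (?S 1) + prob (?S (- 1))"
    by (rule measure_Un_le) measurable
  also have "\<dots> \<le> 2 * exp (- (real n * t\<^sup>2 / (128 * \<kappa>\<^sup>2)))"
    using tail[of 1] tail[of "- 1"] by simp
  finally show ?thesis .
qed

text \<open>Both integrals are taken against the common law on \<open>vec_space p\<close>, so
  moments computed on \<open>M\<close> carry over to the samples on \<open>N\<close>.\<close>

lemma iid_copies_integral:
  fixes f :: "(nat \<Rightarrow> real) \<Rightarrow> real"
  assumes "prob_space N" and iid: "iid_copies N M p X n Xs" and i: "i < n"
    and X: "X \<in> M \<rightarrow>\<^sub>M vec_space p" and f: "f \<in> borel_measurable (vec_space p)"
  shows "integrable N (\<lambda>\<omega>. f (Xs i \<omega>)) \<longleftrightarrow> integrable M (\<lambda>\<omega>. f (X \<omega>))"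
    and "(\<integral>\<omega>. f (Xs i \<omega>) \<partial>N) = (\<integral>\<omega>. f (X \<omega>) \<partial>M)"
proof -
  interpret N: prob_space N by fact
  have Xs: "Xs i \<in> N \<rightarrow>\<^sub>M vec_space p"
    using iid i by (auto simp: iid_copies_def N.indep_vars_def)
  have d: "distr N (vec_space p) (Xs i) = distr M (vec_space p) X"
    using iid i by (auto simp: iid_copies_def)
  show "integrable N (\<lambda>\<omega>. f (Xs i \<omega>)) \<longleftrightarrow> integrable M (\<lambda>\<omega>. f (X \<omega>))"
    using integrable_distr_eq[OF Xs f] integrable_distr_eq[OF X f] d by simp
  show "(\<integral>\<omega>. f (Xs i \<omega>) \<partial>N) = (\<integral>\<omega>. f (X \<omega>) \<partial>M)"
    using integral_distr[OF Xs f] integral_distr[OF X f] d by simp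
qed

text \<open>The deviation of an entry is the average of \<open>n\<close> independent centred
  products, each with the moment generating function bound of \<open>product_mgf_le\<close>.\<close>

lemma sample_cov_entry_tail:
  assumes "prob_space M" "prob_space N" and iid: "iid_copies N M p X n Xs" and n: "0 < n"
    and X: "X \<in> M \<rightarrow>\<^sub>M vec_space p" and ab: "a < p" "b < p"
    and sub: "sub_gaussian M \<tau> (\<lambda>\<omega>. X \<omega> a)" "sub_gaussian M \<tau> (\<lambda>\<omega>. X \<omega> b)"
    and \<tau>: "\<tau> > 0" "4 * \<tau>\<^sup>2 \<le> \<kappa>"
    and int: "integrable M (\<lambda>\<omega>. X \<omega> a * X \<omega> b)"
    and \<mu>: "\<bar>cov_mat M p X $$ (a, b)\<bar> \<le> \<kappa>" and t: "0 < t" "t \<le> \<kappa>"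
  shows "measure N {\<omega> \<in> space N. \<bar>sample_cov p n (\<lambda>i. Xs i \<omega>) $$ (a, b) - cov_mat M p X $$ (a, b)\<bar> \<ge> t}
    \<le> 2 * exp (- (real n * t\<^sup>2 / (128 * \<kappa>\<^sup>2)))"
proof -
  interpret M: prob_space M by fact
  interpret N: prob_space N by fact
  define \<mu> where "\<mu> = (\<integral>\<omega>. X \<omega> a * X \<omega> b \<partial>M)"
  have \<mu>_eq: "cov_mat M p X $$ (a, b) = \<mu>" using ab by (simp add: cov_mat_def \<mu>_def)
  have comp [measurable]: "(\<lambda>x. x a) \<in> borel_measurable (vec_space p)" "(\<lambda>x. x b) \<in> borel_measurable (vec_space p)"
    using ab by (auto intro!: measurable_component_singleton)
  have Xm: "(\<lambda>\<omega>. X \<omega> a) \<in> borel_measurable M" "(\<lambda>\<omega>. X \<omega> b) \<in> borel_measurable M"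
    using measurable_compose[OF X comp(1)] measurable_compose[OF X comp(2)] by auto
  have prod: "integrable M (\<lambda>\<omega>. exp (s * (X \<omega> a * X \<omega> b - \<mu>)))"
      "(\<integral>\<omega>. exp (s * (X \<omega> a * X \<omega> b - \<mu>)) \<partial>M) \<le> exp (12 * s\<^sup>2 * \<kappa>\<^sup>2)" if "\<bar>s\<bar> * \<kappa> \<le> 1 / 2" for s
    using M.product_mgf_le[OF Xm sub \<tau> int \<mu>_def _ that] \<mu> by (simp_all add: \<mu>_eq)
  let ?V = "\<lambda>i \<omega>. Xs i \<omega> a * Xs i \<omega> b - \<mu>"
  have f: "(\<lambda>x. exp (s * (x a * x b - \<mu>))) \<in> borel_measurable (vec_space p)" for s :: real
    by measurable
  have "N.indep_vars (\<lambda>_. vec_space p) Xs {..<n}"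
    using iid by (simp add: iid_copies_def)
  then have indep: "N.indep_vars (\<lambda>_. borel) ?V {..<n}"
    by (rule N.indep_vars_compose2) measurable
  have tail: "N.prob {\<omega> \<in> space N. \<bar>\<Sum>i<n. ?V i \<omega>\<bar> \<ge> real n * t} \<le> 2 * exp (- (real n * t\<^sup>2 / (128 * \<kappa>\<^sup>2)))"
  proof (rule N.sum_abs_tail[OF indep _ _ t])
    fix i and s :: real assume i: "i < n" and s: "\<bar>s\<bar> * \<kappa> \<le> 1 / 2"
    show "integrable N (\<lambda>\<omega>. exp (s * ?V i \<omega>))"
      using iid_copies_integral(1)[OF assms(2) iid i X f] prod(1)[OF s] by blast
    show "(\<integral>\<omega>. exp (s * ?V i \<omega>) \<partial>N) \<le> exp (12 * s\<^sup>2 * \<kappa>\<^sup>2)"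
      using iid_copies_integral(2)[OF assms(2) iid i X f] prod(2)[OF s] by simp
  qed
  have "real n * t \<le> \<bar>\<Sum>i<n. ?V i \<omega>\<bar> \<longleftrightarrow> t \<le> \<bar>sample_cov p n (\<lambda>i. Xs i \<omega>) $$ (a, b) - \<mu>\<bar>" for \<omega>
  proof -
    have "sample_cov p n (\<lambda>i. Xs i \<omega>) $$ (a, b) - \<mu> = (\<Sum>i<n. ?V i \<omega>) / real n"
      using ab n by (simp add: sample_cov_def sum_subtractf field_simps)
    then show ?thesis using n by (simp only: abs_divide) (simp add: pos_le_divide_eq mult.commute)
  qed
  with tail show ?thesis by (simp add: \<mu>_eq)
qed

subsection \<open>The structural equation model\<close>

lemma sum_unit_mult:
  fixes f :: "nat \<Rightarrow> real"
  assumes "a < p"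
  shows "(\<Sum>k<p. (if k = a then 1 else 0) * f k) = f a"
proof -
  have "(\<Sum>k<p. (if k = a then 1 else 0) * f k) = (\<Sum>k\<in>{a}. (if k = a then 1 else 0) * f k)"
    using assms by (intro sum.mono_neutral_right) auto
  then show ?thesis by simp
qed

lemma Max_diag_ge: "a < p \<Longrightarrow> C $$ (a, a) \<le> Max ((\<lambda>j. C $$ (j, j)) ` {..<p})"
  by (intro Max_ge) auto

text \<open>Fixes the noise whose existence the model asserts. The assumptions concern second
  moments; the sub-Gaussian bound enters as a hypothesis of \<open>sub_gaussian_X\<close>.\<close>

locale equal_var_sem = prob_space M
  for M :: "'a measure" and p :: nat and B :: "real mat" and \<sigma> :: real
    and X :: "'a \<Rightarrow> nat \<Rightarrow> real" and e :: "nat \<Rightarrow> 'a \<Rightarrow> real" +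
  assumes B: "B \<in> carrier_mat p p" and diag: "\<And>j. j < p \<Longrightarrow> B $$ (j, j) = 0"
    and acyc: "acyclic (edges B)"
    and noise: "equal_var_noise M p \<sigma> e" and sol: "solves_sem M p B X e"
begin

lemma e_indep: "indep_vars (\<lambda>_. borel) e {..<p}"
  using noise by (simp add: equal_var_noise_def)

lemma e_measurable [measurable]: "j < p \<Longrightarrow> e j \<in> borel_measurable M"
  using e_indep by (auto simp: indep_vars_def)

lemma X_measurable: "X \<in> M \<rightarrow>\<^sub>M vec_space p"
  using sol by (simp add: solves_sem_def)

lemma X_comp_measurable [measurable]: "a < p \<Longrightarrow> (\<lambda>\<omega>. X \<omega> a) \<in> borel_measurable M"
  by (rule measurable_compose[OF X_measurable measurable_component_singleton]) simp

lemma noise_product: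
  assumes "i < p" "j < p"
  shows "integrable M (\<lambda>\<omega>. e i \<omega> * e j \<omega>)"
    and "(\<integral>\<omega>. e i \<omega> * e j \<omega> \<partial>M) = (if i = j then \<sigma>\<^sup>2 else 0)"
proof -
  have "integrable M (\<lambda>\<omega>. e i \<omega> * e j \<omega>) \<and> (\<integral>\<omega>. e i \<omega> * e j \<omega> \<partial>M) = (if i = j then \<sigma>\<^sup>2 else 0)"
  proof (cases "i = j")
    case True
    with assms noise show ?thesis by (simp add: equal_var_noise_def power2_eq_square)
  next
    case False
    have ind: "indep_vars (\<lambda>_. borel) e {i, j}"
      using assms by (intro indep_vars_subset[OF e_indep]) auto
    have int: "integrable M (e k)" if "k \<in> {i, j}" for k
      using noise that assms by (auto simp: equal_var_noise_def)
    have "(\<integral>\<omega>. e i \<omega> \<partial>M) = 0" using noise assms by (simp add: equal_var_noise_def)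
    then show ?thesis
      using indep_vars_lebesgue_integral[OF _ ind int] indep_vars_integrable[OF _ ind int] False by simp
  qed
  then show "integrable M (\<lambda>\<omega>. e i \<omega> * e j \<omega>)"
    "(\<integral>\<omega>. e i \<omega> * e j \<omega> \<partial>M) = (if i = j then \<sigma>\<^sup>2 else 0)" by auto
qed

lemma noise_comb_product:
  shows "integrable M (\<lambda>\<omega>. (\<Sum>i<p. u i * e i \<omega>) * (\<Sum>j<p. w j * e j \<omega>))"
    and "(\<integral>\<omega>. (\<Sum>i<p. u i * e i \<omega>) * (\<Sum>j<p. w j * e j \<omega>) \<partial>M) = \<sigma>\<^sup>2 * (\<Sum>i<p. u i * w i)"
proof -
  have expand: "(\<Sum>i<p. u i * e i \<omega>) * (\<Sum>j<p. w j * e j \<omega>) = (\<Sum>i<p. \<Sum>j<p. u i * w j * (e i \<omega> * e j \<omega>))" for \<omega>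
    unfolding sum_product by (intro sum.cong refl) (simp only: mult_ac)
  have int: "integrable M (\<lambda>\<omega>. u i * w j * (e i \<omega> * e j \<omega>))" if "i \<in> {..<p}" "j \<in> {..<p}" for i j
    using noise_product(1)[of i j] that by auto
  have int': "integrable M (\<lambda>\<omega>. \<Sum>j<p. u i * w j * (e i \<omega> * e j \<omega>))" if "i \<in> {..<p}" for i
    by (intro Bochner_Integration.integrable_sum int that)
  show "integrable M (\<lambda>\<omega>. (\<Sum>i<p. u i * e i \<omega>) * (\<Sum>j<p. w j * e j \<omega>))"
    unfolding expand by (intro Bochner_Integration.integrable_sum int')
  have "(\<integral>\<omega>. (\<Sum>i<p. u i * e i \<omega>) * (\<Sum>j<p. w j * e j \<omega>) \<partial>M) =
    (\<Sum>i<p. \<integral>\<omega>. (\<Sum>j<p. u i * w j * (e i \<omega> * e j \<omega>)) \<partial>M)"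
    unfolding expand by (intro Bochner_Integration.integral_sum int')
  also have "\<dots> = (\<Sum>i<p. \<Sum>j<p. \<integral>\<omega>. u i * w j * (e i \<omega> * e j \<omega>) \<partial>M)"
    by (intro sum.cong refl Bochner_Integration.integral_sum int)
  also have "\<dots> = (\<Sum>i<p. \<Sum>j<p. if i = j then \<sigma>\<^sup>2 * (u i * w j) else 0)"
    by (intro sum.cong refl) (auto simp: noise_product(2))
  also have "\<dots> = \<sigma>\<^sup>2 * (\<Sum>i<p. u i * w i)"
    by (simp add: sum_distrib_left)
  finally show "(\<integral>\<omega>. (\<Sum>i<p. u i * e i \<omega>) * (\<Sum>j<p. w j * e j \<omega>) \<partial>M) = \<sigma>\<^sup>2 * (\<Sum>i<p. u i * w i)" .
qed

text \<open>Inserting \<epsilon> = (I - B) X and exchanging the sums moves I - B onto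
  \<open>u\<close> as its transpose, which yields \<open>v\<close>. The identity holds almost
  everywhere, as the structural equations do.\<close>

lemma comb_eq_noise:
  assumes u: "noise_coeffs p B v u"
  shows "AE \<omega> in M. (\<Sum>k<p. v k * X \<omega> k) = (\<Sum>j<p. u j * e j \<omega>)"
proof -
  have "AE \<omega> in M. \<forall>j\<in>{..<p}. X \<omega> j = (\<Sum>k\<in>{..<p} - {j}. B $$ (j, k) * X \<omega> k) + e j \<omega>"
    using sol by (intro AE_finite_allI) (auto simp: solves_sem_def)
  then show ?thesis
  proof eventually_elim
    case (elim \<omega>)
    have e_eq: "e j \<omega> = X \<omega> j - (\<Sum>k<p. B $$ (j, k) * X \<omega> k)" if "j < p" for j
    proof -
      have "(\<Sum>k<p. B $$ (j, k) * X \<omega> k) = (\<Sum>k\<in>{..<p} - {j}. B $$ (j, k) * X \<omega> k)"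
        using that diag[OF that] by (simp add: sum.remove)
      moreover have "X \<omega> j = (\<Sum>k\<in>{..<p} - {j}. B $$ (j, k) * X \<omega> k) + e j \<omega>"
        using elim that by blast
      ultimately show ?thesis by linarith
    qed
    have "(\<Sum>j<p. u j * e j \<omega>) = (\<Sum>j<p. u j * X \<omega> j) - (\<Sum>j<p. \<Sum>k<p. u j * (B $$ (j, k) * X \<omega> k))"
      by (simp add: e_eq algebra_simps sum_subtractf sum_distrib_left)
    also have "(\<Sum>j<p. \<Sum>k<p. u j * (B $$ (j, k) * X \<omega> k)) = (\<Sum>k<p. \<Sum>j<p. u j * (B $$ (j, k) * X \<omega> k))"
      by (rule sum.swap)
    also have "\<dots> = (\<Sum>k<p. (\<Sum>c<p. B $$ (c, k) * u c) * X \<omega> k)"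
      unfolding sum_distrib_right by (intro sum.cong refl) (simp only: mult_ac)
    also have "(\<Sum>j<p. u j * X \<omega> j) - \<dots> = (\<Sum>k<p. (u k - (\<Sum>c<p. B $$ (c, k) * u c)) * X \<omega> k)"
      by (simp add: sum_subtractf algebra_simps)
    also have "\<dots> = (\<Sum>k<p. v k * X \<omega> k)"
    proof (intro sum.cong refl)
      fix k assume "k \<in> {..<p}"
      then have "u k = v k + (\<Sum>c<p. B $$ (c, k) * u c)" using u unfolding noise_coeffs_def by blast
      then have "u k - (\<Sum>c<p. B $$ (c, k) * u c) = v k" by linarith
      then show "(u k - (\<Sum>c<p. B $$ (c, k) * u c)) * X \<omega> k = v k * X \<omega> k" by (simp only:)
    qed
    finally show ?case ..
  qed
qed

section \<open>Moments and tails of the observed vector\<close>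

lemma X_eq_noise:
  assumes a: "a < p"
  obtains u where "AE \<omega> in M. X \<omega> a = (\<Sum>j<p. u j * e j \<omega>)"
proof -
  obtain u where u: "noise_coeffs p B (\<lambda>k. if k = a then 1 else 0) u"
    using noise_coeffs_exist[OF B acyc] by blast
  have "(\<Sum>k<p. (if k = a then 1 else 0) * X \<omega> k) = X \<omega> a" for \<omega>
    by (rule sum_unit_mult[OF a])
  with comb_eq_noise[OF u] that show ?thesis by simp
qed

lemma integrable_X_product:
  assumes "a < p" "b < p"
  shows "integrable M (\<lambda>\<omega>. X \<omega> a * X \<omega> b)"
proof -
  obtain u where u: "AE \<omega> in M. X \<omega> a = (\<Sum>j<p. u j * e j \<omega>)" using X_eq_noise[OF assms(1)] .
  obtain w where w: "AE \<omega> in M. X \<omega> b = (\<Sum>j<p. w j * e j \<omega>)" using X_eq_noise[OF assms(2)] .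
  have "AE \<omega> in M. (\<Sum>i<p. u i * e i \<omega>) * (\<Sum>j<p. w j * e j \<omega>) = X \<omega> a * X \<omega> b"
    using u w by eventually_elim simp
  then show ?thesis
    using assms by (intro integrable_cong_AE_imp[OF noise_comb_product(1)[of u w]]) measurable
qed

text \<open>The form is the second moment of the linear combination with weights \<open>v\<close>;
  in noise coordinates the mixed moments vanish.\<close>

lemma quad_form_cov_mat:
  assumes u: "noise_coeffs p B v u"
  shows "quad_form p (cov_mat M p X) v = \<sigma>\<^sup>2 * (\<Sum>k<p. (u k)\<^sup>2)"
proof -
  have int: "integrable M (\<lambda>\<omega>. v a * v b * (X \<omega> a * X \<omega> b))" if "a \<in> {..<p}" "b \<in> {..<p}" for a b
    using integrable_X_product[of a b] that by auto
  have expand: "(\<Sum>a<p. v a * X \<omega> a) * (\<Sum>b<p. v b * X \<omega> b) = (\<Sum>a<p. \<Sum>b<p. v a * v b * (X \<omega> a * X \<omega> b))" for \<omega>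
    unfolding sum_product by (intro sum.cong refl) (simp only: mult_ac)
  have int': "integrable M (\<lambda>\<omega>. \<Sum>b<p. v a * v b * (X \<omega> a * X \<omega> b))" if "a \<in> {..<p}" for a
    by (intro Bochner_Integration.integrable_sum int that)
  have "quad_form p (cov_mat M p X) v = (\<Sum>a<p. \<Sum>b<p. \<integral>\<omega>. v a * v b * (X \<omega> a * X \<omega> b) \<partial>M)"
    unfolding quad_form_altdef by (intro sum.cong refl) (auto simp: cov_mat_def)
  also have "\<dots> = (\<Sum>a<p. \<integral>\<omega>. (\<Sum>b<p. v a * v b * (X \<omega> a * X \<omega> b)) \<partial>M)"
    by (intro sum.cong refl Bochner_Integration.integral_sum[symmetric] int)
  also have "\<dots> = (\<integral>\<omega>. (\<Sum>a<p. v a * X \<omega> a) * (\<Sum>b<p. v b * X \<omega> b) \<partial>M)"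
    unfolding expand by (intro Bochner_Integration.integral_sum[symmetric] int')
  also have "\<dots> = (\<integral>\<omega>. (\<Sum>i<p. u i * e i \<omega>) * (\<Sum>j<p. u j * e j \<omega>) \<partial>M)"
  proof (rule integral_cong_AE)
    show "AE \<omega> in M. (\<Sum>a<p. v a * X \<omega> a) * (\<Sum>b<p. v b * X \<omega> b) = (\<Sum>i<p. u i * e i \<omega>) * (\<Sum>j<p. u j * e j \<omega>)"
      using comb_eq_noise[OF u] by eventually_elim simp
  qed (auto intro!: borel_measurable_times borel_measurable_sum)
  also have "\<dots> = \<sigma>\<^sup>2 * (\<Sum>k<p. (u k)\<^sup>2)"
    by (simp add: noise_comb_product(2) power2_eq_square)
  finally show ?thesis .
qed

text \<open>Pointwise, |x y| is at most the mean of the squares; integrating leaves the mean of two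
  diagonal entries.\<close>

lemma abs_cov_mat_le:
  assumes ab: "a < p" "b < p" and m: "\<And>c. c < p \<Longrightarrow> cov_mat M p X $$ (c, c) \<le> m"
  shows "\<bar>cov_mat M p X $$ (a, b)\<bar> \<le> m"
proof -
  have aa: "integrable M (\<lambda>\<omega>. (X \<omega> c)\<^sup>2)" "(\<integral>\<omega>. (X \<omega> c)\<^sup>2 \<partial>M) \<le> m" if "c < p" for c
    using integrable_X_product[OF that that] m[OF that] that by (simp_all add: cov_mat_def power2_eq_square)
  have "\<bar>\<integral>\<omega>. X \<omega> a * X \<omega> b \<partial>M\<bar> \<le> (\<integral>\<omega>. \<bar>X \<omega> a * X \<omega> b\<bar> \<partial>M)"
    by (rule integral_abs_bound)
  also have "\<dots> \<le> (\<integral>\<omega>. ((X \<omega> a)\<^sup>2 + (X \<omega> b)\<^sup>2) / 2 \<partial>M)"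
  proof (rule integral_mono)
    show "\<bar>X \<omega> a * X \<omega> b\<bar> \<le> ((X \<omega> a)\<^sup>2 + (X \<omega> b)\<^sup>2) / 2" for \<omega>
      using sum_squares_bound[of "\<bar>X \<omega> a\<bar>" "\<bar>X \<omega> b\<bar>"] by (simp add: abs_mult)
  qed (use integrable_X_product[OF ab] aa ab in auto)
  also have "\<dots> \<le> m" using aa[OF ab(1)] aa[OF ab(2)] by simp
  finally show ?thesis using ab by (simp add: cov_mat_def)
qed

text \<open>By independence the moment generating function of a noise combination factorises, with
  squared parameter \<gamma>^2 times the sum of squared coefficients. That sum is the variance of
  the coordinate divided by \<open>\<sigma>\<^sup>2\<close>.\<close>

lemma sub_gaussian_X:
  assumes \<gamma>: "\<And>j. j < p \<Longrightarrow> sub_gaussian M \<gamma> (e j)" and a: "a < p" and \<sigma>: "\<sigma> > 0"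
    and \<tau>: "\<gamma>\<^sup>2 / \<sigma>\<^sup>2 * cov_mat M p X $$ (a, a) \<le> \<tau>\<^sup>2"
  shows "sub_gaussian M \<tau> (\<lambda>\<omega>. X \<omega> a)"
  unfolding sub_gaussian_def
proof (intro allI)
  fix t :: real
  obtain u where u: "noise_coeffs p B (\<lambda>k. if k = a then 1 else 0) u"
    using noise_coeffs_exist[OF B acyc] by blast
  have "(\<Sum>k<p. (if k = a then 1 else 0) * X \<omega> k) = X \<omega> a" for \<omega>
    by (rule sum_unit_mult[OF a])
  then have X_eq: "AE \<omega> in M. X \<omega> a = (\<Sum>j<p. u j * e j \<omega>)"
    using comb_eq_noise[OF u] by simp
  have "cov_mat M p X $$ (a, a) = \<sigma>\<^sup>2 * (\<Sum>k<p. (u k)\<^sup>2)"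
    using quad_form_cov_mat[OF u] quad_form_unit[OF a] by simp
  then have \<tau>': "\<gamma>\<^sup>2 * (\<Sum>k<p. (u k)\<^sup>2) \<le> \<tau>\<^sup>2" using \<tau> \<sigma> by simp
  have ind: "indep_vars (\<lambda>_. borel) (\<lambda>j \<omega>. exp ((t * u j) * e j \<omega>)) {..<p}"
    by (rule indep_vars_compose2[OF e_indep]) measurable
  have int: "integrable M (\<lambda>\<omega>. exp ((t * u j) * e j \<omega>))" if "j \<in> {..<p}" for j
    using \<gamma> that by (simp add: sub_gaussian_def)
  let ?P = "\<lambda>\<omega>. \<Prod>j<p. exp ((t * u j) * e j \<omega>)"
  have P_int: "integrable M ?P"
    by (rule indep_vars_integrable[OF _ ind int]) auto
  have P_eq: "AE \<omega> in M. ?P \<omega> = exp (t * X \<omega> a)"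
    using X_eq by eventually_elim (simp add: exp_sum[symmetric] sum_distrib_left mult_ac)
  have meas: "(\<lambda>\<omega>. exp (t * X \<omega> a)) \<in> borel_measurable M" using a by measurable
  have "(\<integral>\<omega>. exp (t * X \<omega> a) \<partial>M) = (\<integral>\<omega>. ?P \<omega> \<partial>M)"
    using P_eq by (intro integral_cong_AE meas borel_measurable_integrable[OF P_int]) (auto elim: eventually_mono)
  also have "\<dots> = (\<Prod>j<p. \<integral>\<omega>. exp ((t * u j) * e j \<omega>) \<partial>M)"
    by (rule indep_vars_lebesgue_integral[OF _ ind int]) auto
  also have "\<dots> \<le> (\<Prod>j<p. exp (\<gamma>\<^sup>2 * (t * u j)\<^sup>2 / 2))"
    using \<gamma> by (intro prod_mono) (auto simp: sub_gaussian_def)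
  also have "\<dots> = exp (t\<^sup>2 / 2 * (\<gamma>\<^sup>2 * (\<Sum>k<p. (u k)\<^sup>2)))"
    by (simp add: exp_sum[symmetric] sum_distrib_left power_mult_distrib mult_ac)
  also have "\<dots> \<le> exp (t\<^sup>2 / 2 * \<tau>\<^sup>2)"
    using \<tau>' by (simp add: mult_left_mono)
  finally have "(\<integral>\<omega>. exp (t * X \<omega> a) \<partial>M) \<le> exp (\<tau>\<^sup>2 * t\<^sup>2 / 2)" by (simp add: mult_ac)
  moreover have "integrable M (\<lambda>\<omega>. exp (t * X \<omega> a))"
    by (rule integrable_cong_AE_imp[OF P_int meas P_eq])
  ultimately show "integrable M (\<lambda>\<omega>. exp (t * X \<omega> a)) \<and> (\<integral>\<omega>. exp (t * X \<omega> a) \<partial>M) \<le> exp (\<tau>\<^sup>2 * t\<^sup>2 / 2)" by blast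
qed

end

lemma sym_on_sample_cov: "sym_on p (sample_cov p n x)"
  by (simp add: sym_on_def sample_cov_def mult.commute)

section \<open>From the sample size to the failure probability\<close>

theorem theorem2:
  fixes M :: "'a measure" and N :: "'b measure"
    and B :: "real mat" and \<sigma> \<gamma> \<zeta> \<epsilon> lmin :: real and p n :: nat
    and X :: "'a \<Rightarrow> nat \<Rightarrow> real" and Xs :: "nat \<Rightarrow> 'b \<Rightarrow> nat \<Rightarrow> real" and Cov :: "real mat"
  assumes "prob_space M" and "prob_space N"
    and "p \<ge> 1" and "\<sigma> > 0" and "\<gamma> > 0"
    and "sub_gaussian_sem M p B \<sigma> \<gamma> X"
    and "acyclic (edges B)"
    and "edges B \<noteq> {} \<Longrightarrow> \<zeta> = Min ((\<lambda>(k, j). (B $$ (j, k))\<^sup>2) ` edges B)"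
    and "edges B = {} \<Longrightarrow> \<zeta> > 0"
    and "Cov = cov_mat M p X"
    and "lmin = Min (spectrum Cov)" and "lmin > 0"
    and "\<epsilon> > 0"
    and "iid_copies N M p X n Xs"
    and "real n > (real p)\<^sup>2 * (ln ((real p)\<^sup>2 + real p) - ln (\<epsilon> / 2)) * 128
           * (1 + 4 * (\<gamma>\<^sup>2 / \<sigma>\<^sup>2))\<^sup>2
           * (Max ((\<lambda>j. Cov $$ (j, j)) ` {..<p}))\<^sup>2
           * ((\<zeta> * lmin + 2 * \<sigma>\<^sup>2) / (\<zeta> * lmin\<^sup>2))\<^sup>2"
  shows "\<exists>G \<in> sets N. measure N G \<ge> 1 - \<epsilon> \<and>
           (\<forall>\<omega>\<in>G. \<forall>u \<theta>. topo_alg_output p (f1 u) (sample_cov p n (\<lambda>i. Xs i \<omega>)) \<theta> \<longrightarrow>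
              topological_ordering p (edges B) \<theta>)"
proof -
  interpret N: prob_space N by fact
  obtain e where B: "B \<in> carrier_mat p p" and diag: "\<forall>j<p. B $$ (j, j) = 0"
    and noise: "equal_var_noise M p \<sigma> e" and sol: "solves_sem M p B X e"
    and sub: "\<forall>j<p. sub_gaussian M \<gamma> (e j)"
    using assms(6) by (auto simp: sub_gaussian_sem_def)
  interpret sem: equal_var_sem M p B \<sigma> X e
    using assms(1,7) B diag noise sol by (intro equal_var_sem.intro equal_var_sem_axioms.intro) auto
  have C: "Cov \<in> carrier_mat p p" by (simp add: assms(10) cov_mat_def)
  have C_sym: "sym_on p Cov" by (simp add: assms(10) sym_on_def cov_mat_def mult.commute)
  have \<zeta>_le: "\<zeta> \<le> (B $$ (j, k))\<^sup>2" if "(k, j) \<in> edges B" for j k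
  proof -
    have "\<zeta> = Min ((\<lambda>(k, j). (B $$ (j, k))\<^sup>2) ` edges B)" using that by (intro assms(8)) auto
    also have "\<dots> \<le> (B $$ (j, k))\<^sup>2" using that finite_edges by (intro Min_le) (auto intro: rev_image_eqI)
    finally show ?thesis .
  qed
  have "\<zeta> > 0"
  proof (cases "edges B = {}")
    case False
    then have "\<zeta> \<in> (\<lambda>(k, j). (B $$ (j, k))\<^sup>2) ` edges B"
      unfolding assms(8)[OF False] using finite_edges by (intro Min_in) auto
    then show ?thesis by (auto simp: edges_def)
  qed (rule assms(9))
  interpret sc: sem_cov p B Cov \<sigma> \<zeta> lmin
  proof
    show "lmin * (\<Sum>i<p. (v i)\<^sup>2) \<le> quad_form p Cov v" for v
      unfolding assms(11) by (rule Min_spectrum_le_quad_form[OF C C_sym])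
    show "quad_form p Cov v = \<sigma>\<^sup>2 * (\<Sum>k<p. (u k)\<^sup>2)" if "noise_coeffs p B v u" for v u
      unfolding assms(10) by (rule sem.quad_form_cov_mat[OF that])
  qed (use assms B diag \<open>\<zeta> > 0\<close> \<zeta>_le in auto)
  \<comment> \<open>\<kappa> collects the model factors of the sample size, \<tau> is a common
    sub-Gaussian parameter for all coordinates, and \<delta> is the largest entrywise error that
    \<open>topo_alg_correct\<close> admits.\<close>
  define m where "m = Max ((\<lambda>j. Cov $$ (j, j)) ` {..<p})"
  define r where "r = \<gamma>\<^sup>2 / \<sigma>\<^sup>2"
  define \<kappa> where "\<kappa> = m * (1 + 4 * r)"
  define \<tau> where "\<tau> = sqrt (r * m)"
  define L where "L = ln ((real p)\<^sup>2 + real p) - ln (\<epsilon> / 2)"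
  define \<delta> where "\<delta> = \<zeta> * lmin\<^sup>2 / (real p * (\<zeta> * lmin + 2 * \<sigma>\<^sup>2))"
  have p0: "0 < p" using assms(3) by simp
  have m_ge: "Cov $$ (a, a) \<le> m" if "a < p" for a
    unfolding m_def by (rule Max_diag_ge[OF that])
  have "lmin \<le> m"
  proof -
    let ?v = "\<lambda>i. if i = 0 then 1 else (0::real)"
    have "lmin * (\<Sum>i<p. (?v i)\<^sup>2) \<le> quad_form p Cov ?v" by (rule sc.l(2))
    then have "lmin \<le> Cov $$ (0, 0)"
      using noise_variance_unit[OF p0] quad_form_unit[OF p0] by simp
    with m_ge[OF p0] show ?thesis by linarith
  qed
  then have m0: "0 < m" using assms(12) by linarith
  have r0: "0 < r" using assms(4,5) by (simp add: r_def)
  have \<tau>0: "0 < \<tau>" using m0 r0 by (simp add: \<tau>_def)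
  have \<tau>2: "\<tau>\<^sup>2 = r * m" using m0 r0 by (simp add: \<tau>_def)
  have "m \<le> \<kappa>" unfolding \<kappa>_def using m0 r0 by simp
  then have \<kappa>0: "0 < \<kappa>" using m0 by linarith
  have \<kappa>\<tau>: "4 * \<tau>\<^sup>2 \<le> \<kappa>" using m0 by (simp add: \<tau>2 \<kappa>_def algebra_simps)
  have den: "0 < \<zeta> * lmin + 2 * \<sigma>\<^sup>2"
    using \<open>\<zeta> > 0\<close> assms(4,12) by (intro add_pos_pos) auto
  have \<delta>0: "0 < \<delta>" unfolding \<delta>_def using \<open>\<zeta> > 0\<close> assms(12) p0 den by simp
  have \<delta>_eq: "real p * \<delta> * (\<zeta> * lmin + 2 * \<sigma>\<^sup>2) = \<zeta> * lmin\<^sup>2"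
    unfolding \<delta>_def using p0 den by simp
  \<comment> \<open>The tail bound covers deviations up to \<kappa>, and lmin \<le> m \<le>
    \<kappa>.\<close>
  have "\<delta> \<le> lmin"
  proof -
    have "\<delta> \<le> \<zeta> * lmin\<^sup>2 / (1 * (\<zeta> * lmin))"
      unfolding \<delta>_def using \<open>\<zeta> > 0\<close> assms(3,12) den by (intro divide_left_mono mult_mono mult_pos_pos) auto
    also have "\<dots> = lmin" using \<open>\<zeta> > 0\<close> assms(12) by (simp add: power2_eq_square)
    finally show ?thesis .
  qed
  then have \<delta>\<kappa>: "\<delta> \<le> \<kappa>" using \<open>lmin \<le> m\<close> \<open>m \<le> \<kappa>\<close> by linarith
  have n_bound: "L * (128 * \<kappa>\<^sup>2 / \<delta>\<^sup>2) < real n"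
  proof -
    have "L * (128 * \<kappa>\<^sup>2 / \<delta>\<^sup>2) = (real p)\<^sup>2 * L * 128 * (1 + 4 * r)\<^sup>2 * m\<^sup>2
      * ((\<zeta> * lmin + 2 * \<sigma>\<^sup>2) / (\<zeta> * lmin\<^sup>2))\<^sup>2"
      unfolding \<delta>_def \<kappa>_def by (simp add: power_mult_distrib power_divide)
    with assms(15) show ?thesis by (simp only: L_def m_def r_def)
  qed
  show ?thesis
  proof (cases "\<epsilon> < 1")
    \<comment> \<open>For \<epsilon> \<ge> 1 the empty event suffices. Otherwise \<open>L\<close> is
      positive, which forces n > 0.\<close>
    case False
    then show ?thesis by (intro bexI[of _ "{}"]) auto
  next
    case True
    have "1 \<le> (real p)\<^sup>2" using assms(3) by simp
    then have "\<epsilon> / 2 < (real p)\<^sup>2 + real p" "0 < (real p)\<^sup>2 + real p" using True by linarith+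
    then have "ln (\<epsilon> / 2) < ln ((real p)\<^sup>2 + real p)"
      using assms(13) by (subst ln_less_cancel_iff) auto
    then have "0 < L * (128 * \<kappa>\<^sup>2 / \<delta>\<^sup>2)"
      unfolding L_def using \<kappa>0 \<delta>0 by (intro mult_pos_pos divide_pos_pos) auto
    with n_bound have n0: "0 < n" by simp
    let ?D = "\<lambda>a b \<omega>. \<bar>sample_cov p n (\<lambda>i. Xs i \<omega>) $$ (a, b) - Cov $$ (a, b)\<bar>"
    let ?bad = "\<lambda>(a, b). {\<omega> \<in> space N. ?D a b \<omega> \<ge> \<delta>}"
    \<comment> \<open>The event is fixed before the default values \<open>u\<close> and the
      tie-breaking behind \<theta>, so it serves all of them simultaneously.\<close>
    define G where "G = space N - (\<Union>ab\<in>{..<p} \<times> {..<p}. ?bad ab)"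
    have sg: "sub_gaussian M \<tau> (\<lambda>\<omega>. X \<omega> a)" if "a < p" for a
      using sub that assms(4) m_ge[OF that] r0
      by (intro sem.sub_gaussian_X[of \<gamma>]) (auto simp: \<tau>2 r_def[symmetric] assms(10)[symmetric])
    have "\<bar>Cov $$ (a, b)\<bar> \<le> \<kappa>" if "a < p" "b < p" for a b
      using sem.abs_cov_mat_le[OF that, of m] m_ge \<open>m \<le> \<kappa>\<close> by (force simp: assms(10))
    then have tail: "N.prob (?bad ab) \<le> 2 * exp (- (real n * \<delta>\<^sup>2 / (128 * \<kappa>\<^sup>2)))" if "ab \<in> {..<p} \<times> {..<p}" for ab
      using that sample_cov_entry_tail[OF assms(1,2,14) n0 sem.X_measurable _ _ sg sg \<tau>0 \<kappa>\<tau>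
          sem.integrable_X_product _ \<delta>0 \<delta>\<kappa>]
      by (auto simp: assms(10))
    have meas: "?bad ab \<in> sets N" if ab: "ab \<in> {..<p} \<times> {..<p}" for ab
    proof -
      have [measurable]: "(\<lambda>\<omega>. Xs i \<omega> a) \<in> borel_measurable N" if "i < n" "a < p" for i a
        by (rule measurable_compose[OF _ measurable_component_singleton])
          (use assms(14) that in \<open>auto simp: iid_copies_def N.indep_vars_def\<close>)
      show ?thesis
        using ab by (auto simp: sample_cov_def)
    qed
    have union: "(\<Union>ab\<in>{..<p} \<times> {..<p}. ?bad ab) \<in> sets N"
      using meas by (intro sets.finite_UN) auto
    \<comment> \<open>Solving \<open>n_bound\<close> for \<open>L\<close> bounds each one-sided tail
      by (\<epsilon> / 2) / (p^2 + p). Two sides and p^2 entries then cost at most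
      \<epsilon>.\<close>
    have exp_L: "exp (- (real n * \<delta>\<^sup>2 / (128 * \<kappa>\<^sup>2))) \<le> (\<epsilon> / 2) / ((real p)\<^sup>2 + real p)"
    proof -
      have "L < real n / (128 * \<kappa>\<^sup>2 / \<delta>\<^sup>2)"
        using n_bound \<kappa>0 \<delta>0 by (subst pos_less_divide_eq) auto
      then have "- (real n * \<delta>\<^sup>2 / (128 * \<kappa>\<^sup>2)) \<le> ln (\<epsilon> / 2) - ln ((real p)\<^sup>2 + real p)"
        by (simp add: L_def)
      then have "exp (- (real n * \<delta>\<^sup>2 / (128 * \<kappa>\<^sup>2))) \<le> exp (ln (\<epsilon> / 2) - ln ((real p)\<^sup>2 + real p))" by simp
      also have "\<dots> = (\<epsilon> / 2) / ((real p)\<^sup>2 + real p)"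
        using assms(13) p0 by (simp add: exp_diff add_pos_pos)
      finally show ?thesis .
    qed
    have "N.prob (\<Union>ab\<in>{..<p} \<times> {..<p}. ?bad ab) \<le> (\<Sum>ab\<in>{..<p} \<times> {..<p}. N.prob (?bad ab))"
      using meas by (intro N.finite_measure_subadditive_finite) auto
    also have "\<dots> \<le> real (card ({..<p} \<times> {..<p})) * (2 * exp (- (real n * \<delta>\<^sup>2 / (128 * \<kappa>\<^sup>2))))"
      by (rule sum_bounded_above[OF tail])
    also have "real (card ({..<p} \<times> {..<p})) = (real p)\<^sup>2"
      by (simp add: power2_eq_square)
    also have "(real p)\<^sup>2 * (2 * exp (- (real n * \<delta>\<^sup>2 / (128 * \<kappa>\<^sup>2)))) \<le>
        (real p)\<^sup>2 * (2 * ((\<epsilon> / 2) / ((real p)\<^sup>2 + real p)))"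
      by (intro mult_left_mono exp_L) auto
    also have "\<dots> = \<epsilon> * ((real p)\<^sup>2 / ((real p)\<^sup>2 + real p))"
    proof -
      have "(real p)\<^sup>2 * (2 * ((\<epsilon> / 2) / K)) = \<epsilon> * ((real p)\<^sup>2 / K)" for K :: real by simp
      then show ?thesis .
    qed
    also have "\<dots> \<le> \<epsilon> * 1"
      using assms(13) p0 by (intro mult_left_mono) (auto simp: divide_le_eq_1 add_nonneg_pos)
    finally have "N.prob G \<ge> 1 - \<epsilon>"
      unfolding G_def using N.prob_compl[OF union] by simp
    moreover have "G \<in> sets N" unfolding G_def using union by auto
    moreover have "topological_ordering p (edges B) \<theta>"
      if \<omega>: "\<omega> \<in> G" and out: "topo_alg_output p (f1 u) (sample_cov p n (\<lambda>i. Xs i \<omega>)) \<theta>" for \<omega> u \<theta>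
    proof (rule sc.topo_alg_correct[OF _ sym_on_sample_cov _ _ out])
      show "sample_cov p n (\<lambda>i. Xs i \<omega>) \<in> carrier_mat p p" by (simp add: sample_cov_def)
      show "?D a b \<omega> < \<delta>" if "a < p" "b < p" for a b
        using \<omega> that by (force simp: G_def not_le)
      show "real p * \<delta> * (\<zeta> * lmin + 2 * \<sigma>\<^sup>2) \<le> \<zeta> * lmin\<^sup>2" using \<delta>_eq by simp
    qed
    ultimately show ?thesis by blast
  qed
qed

end
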